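(* For each $t\in\mathbb R^m$ such that $\alpha_k(t)\notin\pi\mathbb Z$ for each $k=1,\dots,n$, the kernel $b'_t$ of $\sigma'(t)=\mathcal B^{-1}\sigma(t)\mathcal B$ is $$b'_t(x,y)=\left(\tfrac\lambda\pi\right)^{n/2}\chi(t)\,\mathrm{Det}(I_n-A(t^{-1})^2)^{-1/2}\exp\left(\tfrac\lambda2(x^2+y^2)\right)\exp\Bigl(\lambda\bigl(y(A(t^{-1})^2-I_n)^{-1}y-2xA(t^{-1})(A(t^{-1})^2-I_n)^{-1}y+x(A(t^{-1})^2-I_n)^{-1}x\bigr)\Bigr),$$ or, equivalently, $$b'_t(x,y)=\left(\tfrac\lambda\pi\right)^{n/2}\chi(t)\prod_{k=1}^n(1-e^{-2i\alpha_k(t)})^{-1/2}\exp\left(\tfrac\lambda2\,i\sum_{k=1}^n(\tan\alpha_k(t))^{-1}(x_k^2+y_k^2)-\lambda i\sum_{k=1}^n(\sin\alpha_k(t))^{-1}x_ky_k\right)$$ for $x,y\in\mathbb R^n$, where $(\tan\alpha_k(t))^{-1}$ means $\cos\alpha_k(t)/\sin\alpha_k(t)$.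
   Context: Fix integers $n,m\ge 1$ and $\lambda>0$. For $z,w\in\mathbb C^n$ put $zw:=\sum_k z_kw_k$ (bilinear), $z^2:=zz$, $|z|^2=z\bar z$; for an $n\times n$ matrix $M$, $zMw:=\sum_{j,k}z_jM_{jk}w_k$. Let $\alpha_1,\dots,\alpha_n$ be linear forms on $\mathbb R^m$, $A(t):=\mathrm{Diag}(e^{i\alpha_1(t)},\dots,e^{i\alpha_n(t)})$, $t\cdot z=A(t)z$; $t^{-1}$ means $-t$. For complex numbers, $\zeta^{1/2}$ is the principal square root (cut along the negative real axis), and $\mathrm{Det}(I_n-A(t^{-1})^2)^{-1/2}$ is understood as $\prod_k(1-e^{-2i\alpha_k(t)})^{-1/2}$. $\mathcal F_\lambda$ is the Hilbert space of holomorphic $f$ on $\mathbb C^n$ with $\int_{\mathbb C^n}|f(z)|^2e^{-\lambda|z|^2/2}d\mu_\lambda(z)<\infty$, $d\mu_\lambda=(2\pi)^{-n}\lambda^n\,dx\,dy$, $z=x+iy$. Fix a unitary character $\chi$ of $\mathbb R^m$; $\sigma(t)$ is the unitary operator on $\mathcal F_\lambda$ given by $(\sigma(t)f)(z)=\chi(t)f(t^{-1}\cdot z)$. The Bargmann transform is the unitary operator $\mathcal B:L^2(\mathbb R^n)\to\mathcal F_\lambda$, $$(\mathcal B\phi)(z)=\left(\tfrac\lambda\pi\right)^{n/4}\int_{\mathbb R^n}\exp\left(-\tfrac\lambda4z^2+\lambda zx-\tfrac\lambda2x^2\right)\phi(x)\,dx.$$ The kernel $b'_t$ of $\sigma'(t)$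 is the function such that $(\sigma'(t)\phi)(x)=\int_{\mathbb R^n}b'_t(x,y)\phi(y)\,dy$ (for $\phi$ in the dense subspace $L^1(\mathbb R^n)\cap L^2(\mathbb R^n)$, where the integral converges absolutely). *)

theory Defs
  imports "HOL-Analysis.Analysis"
begin

text \<open>Elements of \<open>L\<^sup>1\<close> and \<open>L\<^sup>2\<close> are represented by Borel functions; identities between
  elements of \<open>L\<^sup>2\<close> are stated almost everywhere.\<close>

definition L1 :: "(real ^ 'n \<Rightarrow> complex) set" where
  "L1 = {\<phi>. integrable lborel \<phi>}"

definition L2 :: "(real ^ 'n \<Rightarrow> complex) set" where
  "L2 = {\<phi> \<in> borel_measurable borel. integrable lborel (\<lambda>x. (norm (\<phi> x))\<^sup>2)}"

definition cvec :: "real ^ 'n \<Rightarrow> complex ^ 'n" where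
  "cvec x = (\<chi> k. complex_of_real (x $ k))"

text \<open>The product \<open>zw\<close> is bilinear, not sesquilinear.\<close>

definition bil :: "complex ^ 'n \<Rightarrow> complex ^ 'n \<Rightarrow> complex" where
  "bil z w = (\<Sum>k\<in>UNIV. z $ k * w $ k)"

definition bilM :: "complex ^ 'n \<Rightarrow> complex ^ 'n ^ 'n \<Rightarrow> complex ^ 'n \<Rightarrow> complex" where
  "bilM z M w = (\<Sum>j\<in>UNIV. \<Sum>k\<in>UNIV. z $ j * M $ j $ k * w $ k)"

definition holomorphic_Cn :: "(complex ^ 'n \<Rightarrow> complex) \<Rightarrow> bool" where
  "holomorphic_Cn f \<longleftrightarrow>
     (\<forall>z. \<exists>D. (f has_derivative D) (at z) \<and> (\<forall>c v. D (c *s v) = c * D v))"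

text \<open>On \<^typ>\<open>complex ^ 'n\<close>, \<^const>\<open>lborel\<close> is the measure \<open>dx dy\<close> for \<open>z = x + iy\<close>.\<close>

definition fock_measure :: "real \<Rightarrow> (complex ^ 'n) measure" where
  "fock_measure lam = density lborel (\<lambda>_. ennreal ((lam / (2 * pi)) ^ CARD('n)))"

definition fock_space :: "real \<Rightarrow> (complex ^ 'n \<Rightarrow> complex) set" where
  "fock_space lam = {f. holomorphic_Cn f \<and>
     integrable (fock_measure lam) (\<lambda>z. (norm (f z))\<^sup>2 * exp (- lam * (norm z)\<^sup>2 / 2))}"

definition bargmann :: "real \<Rightarrow> (real ^ 'n \<Rightarrow> complex) \<Rightarrow> complex ^ 'n \<Rightarrow> complex" where
  "bargmann lam \<phi> z =
     complex_of_real ((lam / pi) powr (real CARD('n) / 4)) *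
     (LINT x|lborel.
        exp (- (of_real lam / 4) * bil z z + of_real lam * bil z (cvec x)
             - (of_real lam / 2) * bil (cvec x) (cvec x)) * \<phi> x)"

text \<open>The representative in \<^const>\<open>L2\<close> is chosen arbitrarily; the Bargmann transform is injective
  only up to equality almost everywhere.\<close>

definition bargmann_inv :: "real \<Rightarrow> (complex ^ 'n \<Rightarrow> complex) \<Rightarrow> real ^ 'n \<Rightarrow> complex" where
  "bargmann_inv lam = inv_into L2 (bargmann lam)"

definition unitary_character :: "(real ^ 'm \<Rightarrow> complex) \<Rightarrow> bool" where
  "unitary_character chi \<longleftrightarrow> continuous_on UNIV chi \<and>
     (\<forall>s t. chi (s + t) = chi s * chi t) \<and> (\<forall>t. norm (chi t) = 1)"

definition torus_mat :: "('n \<Rightarrow> real ^ 'm \<Rightarrow> real) \<Rightarrow> real ^ 'm \<Rightarrow> complex ^ 'n ^ 'n" where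
  "torus_mat \<alpha> t = (\<chi> j k. if j = k then exp (\<i> * of_real (\<alpha> k t)) else 0)"

text \<open>An operator on the Fock space only: it is undefined on other functions.\<close>

definition sigma :: "real \<Rightarrow> ('n \<Rightarrow> real ^ 'm \<Rightarrow> real) \<Rightarrow> (real ^ 'm \<Rightarrow> complex) \<Rightarrow> real ^ 'm \<Rightarrow>
    (complex ^ 'n \<Rightarrow> complex) \<Rightarrow> complex ^ 'n \<Rightarrow> complex" where
  "sigma lam \<alpha> chi t = (\<lambda>f\<in>fock_space lam. (\<lambda>z. chi t * f (torus_mat \<alpha> (- t) *v z)))"

definition sigma' :: "real \<Rightarrow> ('n \<Rightarrow> real ^ 'm \<Rightarrow> real) \<Rightarrow> (real ^ 'm \<Rightarrow> complex) \<Rightarrow> real ^ 'm \<Rightarrow>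
    (real ^ 'n \<Rightarrow> complex) \<Rightarrow> real ^ 'n \<Rightarrow> complex" where
  "sigma' lam \<alpha> chi t = bargmann_inv lam \<circ> sigma lam \<alpha> chi t \<circ> bargmann lam"

definition is_kernel ::
  "((real ^ 'n \<Rightarrow> complex) \<Rightarrow> real ^ 'n \<Rightarrow> complex) \<Rightarrow> (real ^ 'n \<Rightarrow> real ^ 'n \<Rightarrow> complex) \<Rightarrow> bool" where
  "is_kernel T b \<longleftrightarrow> (\<forall>\<phi>\<in>L1 \<inter> L2.
     (\<forall>x. integrable lborel (\<lambda>y. b x y * \<phi> y)) \<and>
     (AE x in lborel. T \<phi> x = (LINT y|lborel. b x y * \<phi> y)))"

text \<open>\<open>Det(M)\<^bsup>-1/2\<^esup>\<close> for a diagonal matrix \<open>M\<close>, as the product of the principal values of the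
  diagonal entries (which may differ by a sign from the principal value at \<open>Det(M)\<close>).\<close>

definition Det_inv_sqrt :: "complex ^ 'n ^ 'n \<Rightarrow> complex" where
  "Det_inv_sqrt M = (\<Prod>k\<in>UNIV. inverse (csqrt (M $ k $ k)))"

definition kernel_mat :: "real \<Rightarrow> ('n \<Rightarrow> real ^ 'm \<Rightarrow> real) \<Rightarrow> (real ^ 'm \<Rightarrow> complex) \<Rightarrow> real ^ 'm \<Rightarrow>
    real ^ 'n \<Rightarrow> real ^ 'n \<Rightarrow> complex" where
  "kernel_mat lam \<alpha> chi t x y =
     (let A = torus_mat \<alpha> (- t); R = matrix_inv (A ** A - mat 1); X = cvec x; Y = cvec y in
      complex_of_real ((lam / pi) powr (real CARD('n) / 2)) * chi t *
      Det_inv_sqrt (mat 1 - A ** A) *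
      exp ((of_real lam / 2) * (bil X X + bil Y Y)) *
      exp (of_real lam * (bilM Y R Y - 2 * bilM X (A ** R) Y + bilM X R X)))"

definition kernel_trig :: "real \<Rightarrow> ('n \<Rightarrow> real ^ 'm \<Rightarrow> real) \<Rightarrow> (real ^ 'm \<Rightarrow> complex) \<Rightarrow> real ^ 'm \<Rightarrow>
    real ^ 'n \<Rightarrow> real ^ 'n \<Rightarrow> complex" where
  "kernel_trig lam \<alpha> chi t x y =
     complex_of_real ((lam / pi) powr (real CARD('n) / 2)) * chi t *
     (\<Prod>k\<in>UNIV. inverse (csqrt (1 - exp (- 2 * \<i> * of_real (\<alpha> k t))))) *
     exp ((of_real lam / 2) * \<i> *
            (\<Sum>k\<in>UNIV. of_real (cos (\<alpha> k t) / sin (\<alpha> k t) * ((x $ k)\<^sup>2 + (y $ k)\<^sup>2)))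
          - of_real lam * \<i> * (\<Sum>k\<in>UNIV. of_real (inverse (sin (\<alpha> k t)) * x $ k * y $ k)))"

end

theory Submission
  imports Defs "HOL-Probability.Distributions" "HOL-Complex_Analysis.Conformal_Mappings"
begin

text \<open>Writing \<open>B\<phi>(u + iv)\<close> as a Gaussian factor times the Fourier transform at \<open>v\<close> of
  \<open>x \<mapsto> exp(-\<lambda>|u - x|\<^sup>2/2) \<phi>(x)\<close> reduces everything about \<open>B\<close> that is needed to two facts on the
  Fourier transform: the inequality half of Plancherel's theorem (which puts \<open>B\<phi>\<close> into the Fock space)
  and uniqueness for integrable functions (which makes \<open>B\<close> injective on \<open>L\<^sup>2\<close>); both follow by Gaussian
  regularisation. The kernel operator is itself a Fourier transform with chirps on both sides, so it
  maps \<open>L\<^sup>1 \<inter> L\<^sup>2\<close> into \<open>L\<^sup>2\<close> by the same inequality. That \<open>B\<close> intertwines it with \<open>\<sigma>(t)\<close> is, after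
  Fubini, a product of one-dimensional Gaussian integrals with complex coefficients; the branch of
  the square root in these comes from analytic continuation from the positive reals. The kernel is
  unique because an integrable function is determined by its integrals over a countable
  intersection-stable generator of the Borel sets.\<close>

section \<open>Complex Gaussian integrals\<close>

text \<open>\<open>sigma\<close> is undefined outside the Fock space and \<open>bargmann_inv\<close>
  picks some preimage in \<open>L2\<close>. The operator is therefore not computed by inverting an
  integral formula: B\<phi> has to be placed in the Fock space, a function \<psi> in
  \<open>L2\<close> with B\<psi> = \<sigma>(t)B\<phi> has to be exhibited, and \<psi> is then the
  answer up to a null set. The candidate \<psi> is the kernel applied to \<phi>. Since the kernel
  has constant modulus, square integrability of \<psi> cannot come from decay; it rests on the
  nonzero frequencies \<open>- lam / sin (\<alpha> k t)\<close> of the Fourier transform inside it.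
  The principal root is the right one in every coordinate because the quadratic coefficient of the
  intertwining integral is \<open>lam / (1 - exp (- 2 * \<i> * \<theta>))\<close>, whose real part
  is always \<open>lam / 2\<close>: it stays in the half-plane in which the principal root is
  holomorphic.\<close>

lemma power2_le_exp:
  fixes t :: real
  assumes "t \<ge> 0"
  shows "t\<^sup>2 \<le> 2 * exp t"
  using exp_lower_Taylor_quadratic[OF assms] assms by simp

text \<open>For \<open>norm v < r / 2\<close>, half of the weight \<open>exp (r * P x)\<close>
  absorbs the growth of the exponential and the other half the factor \<open>(P x)^2\<close> of the
  Taylor remainder, so the integrated error is quadratic in \<open>v\<close>. The parameter space is
  arbitrary because the lemma serves both for the complex coefficients of a Gaussian and for the
  variable of the Bargmann transform. The value of the integrand at the base point \<open>z\<close>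
  is put into \<open>h\<close>.\<close>

lemma exp_integral_has_derivative:
  fixes L :: "'a::euclidean_space \<Rightarrow> 'b::real_normed_vector \<Rightarrow> complex" and h :: "'a::euclidean_space \<Rightarrow> complex"
  assumes h [measurable]: "h \<in> borel_measurable M"
    and L [measurable]: "\<And>v. (\<lambda>x. L x v) \<in> borel_measurable M"
    and P [measurable]: "P \<in> borel_measurable M"
    and lin: "\<And>x. linear (L x)"
    and bound: "\<And>x v. norm (L x v) \<le> P x * norm v" "\<And>x. 0 \<le> P x"
    and r: "r > 0" and int: "integrable M (\<lambda>x. exp (r * P x) * norm (h x))"
  shows "((\<lambda>v. \<integral>x. exp (L x (v - z)) * h x \<partial>M) has_derivative (\<lambda>v. \<integral>x. L x v * h x \<partial>M)) (at z)"
proof -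
  note [simp] = linear_0[OF lin] linear_add[OF lin] linear_scale[OF lin]
  have Pint: "integrable M (\<lambda>x. P x * norm (h x))"
  proof (rule Bochner_Integration.integrable_bound)
    show "integrable M (\<lambda>x. (1 / r) * (exp (r * P x) * norm (h x)))" using int by simp
    show "AE x in M. norm (P x * norm (h x)) \<le> norm ((1 / r) * (exp (r * P x) * norm (h x)))"
    proof (intro AE_I2)
      fix x
      have "r * P x \<le> exp (r * P x)" using exp_ge_add_one_self[of "r * P x"] by linarith
      hence "P x \<le> 1 / r * exp (r * P x)" using r by (simp add: field_simps)
      thus "norm (P x * norm (h x)) \<le> norm ((1 / r) * (exp (r * P x) * norm (h x)))"
        using bound(2)[of x] r mult_right_mono[of "P x" "1 / r * exp (r * P x)" "norm (h x)"]
        by (simp add: abs_mult)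
    qed
  qed measurable
  have Lint: "integrable M (\<lambda>x. L x v * h x)" for v
  proof (rule Bochner_Integration.integrable_bound)
    show "integrable M (\<lambda>x. norm v * (P x * norm (h x)))" using Pint by simp
    show "AE x in M. norm (L x v * h x) \<le> norm (norm v * (P x * norm (h x)))"
    proof (intro AE_I2)
      fix x
      show "norm (L x v * h x) \<le> norm (norm v * (P x * norm (h x)))"
        using mult_right_mono[OF bound(1)[of x v], of "norm (h x)"] bound(2)[of x]
        by (simp add: norm_mult abs_mult algebra_simps)
    qed
  qed measurable
  have hint: "integrable M (\<lambda>x. norm (h x))"
  proof (rule Bochner_Integration.integrable_bound[OF int])
    show "AE x in M. norm (norm (h x)) \<le> norm (exp (r * P x) * norm (h x))"
      using bound(2) r by (intro AE_I2) (simp add: abs_mult mult_le_cancel_right1)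
  qed measurable
  have eint: "integrable M (\<lambda>x. exp (L x v) * h x)" if "norm v \<le> r" for v
  proof (rule Bochner_Integration.integrable_bound[OF int])
    show "AE x in M. norm (exp (L x v) * h x) \<le> norm (exp (r * P x) * norm (h x))"
    proof (intro AE_I2)
      fix x
      have "Re (L x v) \<le> norm (L x v)" by (rule complex_Re_le_cmod)
      also have "\<dots> \<le> P x * norm v" by (rule bound)
      also have "\<dots> \<le> r * P x" using that bound(2)[of x] by (subst mult.commute) (rule mult_right_mono)
      finally show "norm (exp (L x v) * h x) \<le> norm (exp (r * P x) * norm (h x))"
        by (simp add: norm_mult abs_mult mult_right_mono)
    qed
  qed measurable
  \<comment> \<open>The factor \<open>4 / r^2\<close> rewrites \<open>(P x)^2\<close> as
    \<open>(r * P x / 2)^2\<close>; the remaining 2 is the constant of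
    \<open>power2_le_exp\<close>.\<close>
  define C where "C = (8 / r\<^sup>2) * (\<integral>x. exp (r * P x) * norm (h x) \<partial>M)"
  define D where "D = (\<lambda>v. \<integral>x. L x v * h x \<partial>M)"
  have D: "bounded_linear D"
  proof (rule bounded_linear_intro)
    fix x y :: 'b and c :: real
    show "D (x + y) = D x + D y" unfolding D_def
      by (simp add: distrib_right Bochner_Integration.integral_add[OF Lint Lint])
    show "D (c *\<^sub>R x) = c *\<^sub>R D x" unfolding D_def by simp
    show "norm (D x) \<le> norm x * (\<integral>x. P x * norm (h x) \<partial>M)"
    proof -
      have "norm (D x) \<le> (\<integral>y. norm x * (P y * norm (h y)) \<partial>M)"
        unfolding D_def
      proof (rule Bochner_Integration.integral_norm_bound_integral)
        show "integrable M (\<lambda>y. L y x * h y)" by (rule Lint)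
        show "integrable M (\<lambda>y. norm x * (P y * norm (h y)))" using Pint by simp
        fix y show "norm (L y x * h y) \<le> norm x * (P y * norm (h y))"
          using mult_right_mono[OF bound(1)[of y x], of "norm (h y)"]
          by (simp add: norm_mult algebra_simps)
      qed
      thus ?thesis by simp
    qed
  qed
  show ?thesis
    unfolding D_def[symmetric]
  proof (rule has_derivativeI_sandwich[OF _ D])
    show "r / 2 > 0" using r by simp
    show "((\<lambda>y. C * norm (y - z)) \<longlongrightarrow> 0) (at z)"
      by (rule tendsto_eq_intros | rule refl | simp)+
    fix y assume y: "dist y z < r / 2" "y \<noteq> z"
    define v where "v = y - z"
    have v: "norm v < r / 2" "v \<noteq> 0" using y by (auto simp: v_def dist_norm)
    have "norm ((\<integral>x. exp (L x v) * h x \<partial>M) - (\<integral>x. exp (L x 0) * h x \<partial>M) - D v)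
        = norm (\<integral>x. exp (L x v) * h x - exp (L x 0) * h x - L x v * h x \<partial>M)"
      unfolding D_def using eint[of v] eint[of 0] Lint[of v] v r by simp
    also have "\<dots> \<le> (\<integral>x. (norm v)\<^sup>2 * (8 / r\<^sup>2) * (exp (r * P x) * norm (h x)) \<partial>M)"
    proof (rule Bochner_Integration.integral_norm_bound_integral)
      show "integrable M (\<lambda>x. exp (L x v) * h x - exp (L x 0) * h x - L x v * h x)"
        using eint[of v] eint[of 0] Lint[of v] v r by simp
      show "integrable M (\<lambda>x. (norm v)\<^sup>2 * (8 / r\<^sup>2) * (exp (r * P x) * norm (h x)))"
        using int by simp
      fix x
      have le: "norm (L x v) \<le> r * P x / 2"
      proof -
        have "norm (L x v) \<le> P x * norm v" by (rule bound)
        also have "\<dots> \<le> P x * (r / 2)" using v bound(2)[of x] by (intro mult_left_mono) auto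
        finally show ?thesis by (simp add: mult.commute)
      qed
      have "norm (exp (L x v) - 1 - L x v) \<le> exp \<bar>Re (L x v)\<bar> * (norm (L x v))\<^sup>2"
        using Taylor_exp[of "L x v" 1] by (simp add: power2_eq_square algebra_simps)
      also have "\<dots> \<le> exp (r * P x / 2) * (P x * norm v)\<^sup>2"
        using abs_Re_le_cmod[of "L x v"] le bound(1)[of x v] by (intro mult_mono power_mono) auto
      also have "\<dots> = exp (r * P x / 2) * (norm v)\<^sup>2 * (4 / r\<^sup>2) * (r * P x / 2)\<^sup>2"
        using r by (simp add: field_simps power2_eq_square)
      also have "\<dots> \<le> exp (r * P x / 2) * (norm v)\<^sup>2 * (4 / r\<^sup>2) * (2 * exp (r * P x / 2))"
        using r bound(2)[of x] by (intro mult_left_mono power2_le_exp) auto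
      also have "\<dots> = (norm v)\<^sup>2 * (8 / r\<^sup>2) * exp (r * P x)"
        by (simp add: field_simps flip: exp_add)
      finally have "norm (exp (L x v) - 1 - L x v) * norm (h x)
          \<le> (norm v)\<^sup>2 * (8 / r\<^sup>2) * exp (r * P x) * norm (h x)"
        by (intro mult_right_mono) auto
      moreover have "exp (L x v) * h x - exp (L x 0) * h x - L x v * h x = (exp (L x v) - 1 - L x v) * h x"
        by (simp add: algebra_simps)
      ultimately show "norm (exp (L x v) * h x - exp (L x 0) * h x - L x v * h x)
          \<le> (norm v)\<^sup>2 * (8 / r\<^sup>2) * (exp (r * P x) * norm (h x))"
        using norm_mult[of "exp (L x v) - 1 - L x v" "h x"] by (metis mult.assoc)
    qed
    also have "\<dots> = C * norm v * norm v" by (simp add: C_def power2_eq_square)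
    finally show "norm ((\<integral>x. exp (L x (y - z)) * h x \<partial>M) - (\<integral>x. exp (L x (z - z)) * h x \<partial>M) - D (y - z)) / norm (y - z) \<le> C * norm (y - z)"
      using v unfolding v_def by (simp add: divide_le_eq)
  qed
qed

section \<open>Gaussian integrals on the line\<close>

lemma real_gaussian_integral:
  fixes a b :: real
  assumes "a > 0"
  shows "has_bochner_integral lborel (\<lambda>x. exp (- a * x\<^sup>2 + b * x)) (sqrt (pi / a) * exp (b\<^sup>2 / (4 * a)))"
proof -
  \<comment> \<open>Completing the square makes the integrand a multiple of the normal density with
    mean \<open>b / (2 * a)\<close> and variance \<open>1 / (2 * a)\<close>, whose mass is
    1.\<close>
  define \<mu> where "\<mu> = b / (2 * a)"
  define \<sigma> where "\<sigma> = sqrt (1 / (2 * a))"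
  have s: "\<sigma>\<^sup>2 = 1 / (2 * a)" "\<sigma> > 0" using assms by (auto simp: \<sigma>_def)
  have "has_bochner_integral lborel (\<lambda>x. (sqrt (pi / a) * exp (b\<^sup>2 / (4 * a))) * normal_density \<mu> \<sigma> x) ((sqrt (pi / a) * exp (b\<^sup>2 / (4 * a))) * 1)"
    using s by (intro has_bochner_integral_mult_right) (simp add: has_bochner_integral_iff)
  moreover have "(sqrt (pi / a) * exp (b\<^sup>2 / (4 * a))) * normal_density \<mu> \<sigma> x = exp (- a * x\<^sup>2 + b * x)" for x
  proof -
    have "sqrt (2 * pi * \<sigma>\<^sup>2) = sqrt (pi / a)" by (simp add: s)
    moreover have "exp (b\<^sup>2 / (4 * a)) * exp (- (x - \<mu>)\<^sup>2 / (2 * \<sigma>\<^sup>2)) = exp (- a * x\<^sup>2 + b * x)"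
      unfolding exp_add[symmetric] s \<mu>_def using assms
      by (simp add: field_simps power2_eq_square)
    ultimately show ?thesis using assms unfolding normal_density_def by simp
  qed
  ultimately show ?thesis by simp
qed

lemma integrable_complex_gaussian:
  fixes a b :: complex
  assumes "Re a > 0"
  shows "integrable lborel (\<lambda>x::real. exp (- a * of_real (x\<^sup>2) + b * of_real x))"
proof (rule Bochner_Integration.integrable_bound)
  show "integrable lborel (\<lambda>x. exp (- Re a * x\<^sup>2 + Re b * x))"
    using real_gaussian_integral[OF assms, of "Re b"] by (simp add: has_bochner_integral_iff)
qed simp_all

text \<open>Continuation is done in one variable at a time: in \<open>a\<close> over the half-plane
  with \<open>b\<close> real, then in \<open>b\<close> over the whole plane with \<open>a\<close>
  fixed. As \<open>pi / a\<close> has positive real part, \<open>csqrt\<close> never meets its cut,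
  and its sign is settled by the real values of \<open>a\<close>.\<close>

lemma complex_gaussian_integral:
  fixes a b :: complex
  assumes a: "Re a > 0"
  shows "(\<integral>x. exp (- a * of_real (x\<^sup>2) + b * of_real x) \<partial>lborel) = csqrt (of_real pi / a) * exp (b\<^sup>2 / (4 * a))"
proof -
  define J where "J = (\<lambda>a b::complex. \<integral>x. exp (- a * of_real ((x::real)\<^sup>2) + b * of_real x) \<partial>lborel)"
  define K where "K = (\<lambda>a b::complex. csqrt (of_real pi / a) * exp (b\<^sup>2 / (4 * a)))"
  have real_case: "J (of_real a) (of_real b) = K (of_real a) (of_real b)" if "a > 0" for a b :: real
  proof -
    have "J (of_real a) (of_real b) = (\<integral>x. of_real (exp (- a * x\<^sup>2 + b * x)) \<partial>lborel)"
      unfolding J_def by (intro Bochner_Integration.integral_cong) (auto simp flip: exp_of_real)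
    also have "\<dots> = of_real (\<integral>x. exp (- a * x\<^sup>2 + b * x) \<partial>lborel)"
      by (rule integral_complex_of_real)
    also have "(\<integral>x. exp (- a * x\<^sup>2 + b * x) \<partial>lborel) = sqrt (pi / a) * exp (b\<^sup>2 / (4 * a))"
      using real_gaussian_integral[OF that, of b] by (simp add: has_bochner_integral_iff)
    finally show ?thesis using that
      by (simp add: K_def exp_of_real[symmetric] of_real_sqrt flip: csqrt_of_real_nonneg)
  qed
  have hol_a: "(\<lambda>a. J a b) holomorphic_on {a. Re a > 0}" for b
  proof (intro holomorphic_onI)
    fix a0 :: complex assume "a0 \<in> {a. Re a > 0}"
    hence a0: "Re a0 > 0" by simp
    define h where "h = (\<lambda>x::real. exp (- a0 * of_real (x\<^sup>2) + b * of_real x))"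
    have "((\<lambda>v. \<integral>x. exp (- (v - a0) * of_real (x\<^sup>2)) * h x \<partial>lborel)
       has_derivative (\<lambda>v. \<integral>x. - v * of_real (x\<^sup>2) * h x \<partial>lborel)) (at a0)"
    \<comment> \<open>Only half of the decay \<open>Re a0\<close> is spent on the weight, so a
      Gaussian factor is left over.\<close>
    proof (rule exp_integral_has_derivative[where P="\<lambda>x. x\<^sup>2" and r="Re a0 / 2"])
      show "linear (\<lambda>v. - v * complex_of_real (x\<^sup>2))" for x
        by (intro linearI) (auto simp: algebra_simps)
      show "integrable lborel (\<lambda>x. exp (Re a0 / 2 * x\<^sup>2) * cmod (h x))"
      proof -
        have "integrable lborel (\<lambda>x. exp (- (Re a0 / 2) * x\<^sup>2 + Re b * x))"
          using real_gaussian_integral[of "Re a0 / 2" "Re b"] a0 by (simp add: has_bochner_integral_iff)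
        thus ?thesis by (simp add: h_def flip: exp_add)
      qed
    qed (use a0 in \<open>auto simp: h_def norm_mult norm_power\<close>)
    moreover have "(\<lambda>v. \<integral>x. exp (- (v - a0) * of_real (x\<^sup>2)) * h x \<partial>lborel) = (\<lambda>a. J a b)"
      unfolding J_def h_def by (intro ext Bochner_Integration.integral_cong refl) (simp add: algebra_simps flip: exp_add)
    moreover have "(\<lambda>v. \<integral>x. - v * of_real (x\<^sup>2) * h x \<partial>lborel) = (*) (\<integral>x. - of_real (x\<^sup>2) * h x \<partial>lborel)"
    proof
      fix v
      have "(\<integral>x. - v * of_real (x\<^sup>2) * h x \<partial>lborel) = (\<integral>x. v * (- of_real (x\<^sup>2) * h x) \<partial>lborel)"
        by (intro Bochner_Integration.integral_cong) auto
      also have "\<dots> = v * (\<integral>x. - of_real (x\<^sup>2) * h x \<partial>lborel)" by (rule integral_mult_right_zero)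
      also have "\<dots> = (\<integral>x. - of_real (x\<^sup>2) * h x \<partial>lborel) * v" by (rule mult.commute)
      finally show "(\<integral>x. - v * of_real (x\<^sup>2) * h x \<partial>lborel) = (\<integral>x. - of_real (x\<^sup>2) * h x \<partial>lborel) * v" .
    qed
    ultimately have "((\<lambda>a. J a b) has_field_derivative (\<integral>x. - of_real (x\<^sup>2) * h x \<partial>lborel)) (at a0)"
      unfolding has_field_derivative_def by (simp only:)
    hence "(\<lambda>a. J a b) field_differentiable at a0" by (auto simp: field_differentiable_def)
    thus "(\<lambda>a. J a b) field_differentiable at a0 within {a. Re a > 0}"
      by (rule field_differentiable_at_within)
  qed
  have hol_b: "(\<lambda>b. J a b) holomorphic_on UNIV"
  proof (intro holomorphic_onI)
    fix b0 :: complex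
    define h where "h = (\<lambda>x::real. exp (- a * of_real (x\<^sup>2) + b0 * of_real x))"
    have "((\<lambda>v. \<integral>x. exp ((v - b0) * of_real x) * h x \<partial>lborel)
       has_derivative (\<lambda>v. \<integral>x. v * of_real x * h x \<partial>lborel)) (at b0)"
    proof (rule exp_integral_has_derivative[where P="\<lambda>x. \<bar>x\<bar>" and r=1])
      show "linear (\<lambda>v. v * complex_of_real x)" for x
        by (intro linearI) (auto simp: algebra_simps)
      have i: "integrable lborel (\<lambda>x. exp (- (Re a) * x\<^sup>2 + c * x))" for c
        using real_gaussian_integral[of "Re a" c] a by (simp add: has_bochner_integral_iff)
      \<comment> \<open>\<open>exp \<bar>x\<bar>\<close> is at most
        \<open>exp x + exp (- x)\<close>, hence two Gaussians with the linear coefficient shifted by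
        1 and by -1.\<close>
      have "integrable lborel (\<lambda>x. exp (- (Re a) * x\<^sup>2 + (1 + Re b0) * x) + exp (- (Re a) * x\<^sup>2 + (- 1 + Re b0) * x))"
        using i by (intro Bochner_Integration.integrable_add)
      thus "integrable lborel (\<lambda>x. exp (1 * \<bar>x\<bar>) * cmod (h x))"
      proof (rule Bochner_Integration.integrable_bound)
        show "AE x in lborel. norm (exp (1 * \<bar>x\<bar>) * cmod (h x)) \<le> norm (exp (- (Re a) * x\<^sup>2 + (1 + Re b0) * x) + exp (- (Re a) * x\<^sup>2 + (- 1 + Re b0) * x))"
        proof (intro AE_I2)
          fix x
          have "exp (1 * \<bar>x\<bar>) * cmod (h x) \<le> exp (- (Re a) * x\<^sup>2 + (1 + Re b0) * x) + exp (- (Re a) * x\<^sup>2 + (- 1 + Re b0) * x)"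
            by (auto simp: h_def abs_if algebra_simps simp flip: exp_add)
          thus "norm (exp (1 * \<bar>x\<bar>) * cmod (h x)) \<le> norm (exp (- (Re a) * x\<^sup>2 + (1 + Re b0) * x) + exp (- (Re a) * x\<^sup>2 + (- 1 + Re b0) * x))"
            by simp
        qed
      qed (simp add: h_def)
    qed (auto simp: h_def norm_mult mult.commute)
    moreover have "(\<lambda>v. \<integral>x. exp ((v - b0) * of_real x) * h x \<partial>lborel) = (\<lambda>b. J a b)"
      unfolding J_def h_def by (intro ext Bochner_Integration.integral_cong refl) (simp add: algebra_simps flip: exp_add)
    moreover have "(\<lambda>v. \<integral>x. v * of_real x * h x \<partial>lborel) = (*) (\<integral>x. of_real x * h x \<partial>lborel)"
    proof
      fix v
      have "(\<integral>x. v * of_real x * h x \<partial>lborel) = (\<integral>x. v * (of_real x * h x) \<partial>lborel)"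
        by (intro Bochner_Integration.integral_cong) auto
      also have "\<dots> = v * (\<integral>x. of_real x * h x \<partial>lborel)" by (rule integral_mult_right_zero)
      also have "\<dots> = (\<integral>x. of_real x * h x \<partial>lborel) * v" by (rule mult.commute)
      finally show "(\<integral>x. v * of_real x * h x \<partial>lborel) = (\<integral>x. of_real x * h x \<partial>lborel) * v" .
    qed
    ultimately have "((\<lambda>b. J a b) has_field_derivative (\<integral>x. of_real x * h x \<partial>lborel)) (at b0)"
      unfolding has_field_derivative_def by (simp only:)
    thus "(\<lambda>b. J a b) field_differentiable at b0 within UNIV"
      by (auto simp: field_differentiable_def)
  qed
  have pos: "of_real pi / z \<notin> \<real>\<^sub>\<le>\<^sub>0" "z \<noteq> 0" if "Re z > 0" for z :: complex
  proof -
    have "Re (of_real pi / z) > 0"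
      using that by (auto simp: complex_div_gt_0 Re_divide intro!: divide_pos_pos add_pos_nonneg)
    thus "of_real pi / z \<notin> \<real>\<^sub>\<le>\<^sub>0" by (auto simp: complex_nonpos_Reals_iff)
    show "z \<noteq> 0" using that by auto
  qed
  \<comment> \<open>Both continuations start from agreement on the positive reals, which must
    accumulate at a point of the domain; 1 lies in both domains.\<close>
  have lim: "(1::complex) islimpt (of_real ` {x::real. x > 0})"
    unfolding islimpt_approachable
  proof (intro allI impI)
    fix e :: real assume "e > 0"
    moreover have "dist (complex_of_real (1 + e / 2)) 1 = dist (1 + e / 2) 1"
      using dist_of_real[of "1 + e / 2" 1, where 'a=complex] by simp
    moreover have "complex_of_real (1 + e / 2) \<noteq> 1"
      using \<open>e > 0\<close> by (subst of_real_eq_1_iff) simp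
    ultimately show "\<exists>x'\<in>complex_of_real ` {x. 0 < x}. x' \<noteq> 1 \<and> dist x' 1 < e"
      using \<open>e > 0\<close> by (intro bexI[of _ "complex_of_real (1 + e / 2)"] imageI) (auto simp: dist_norm)
  qed
  have step_a: "J a' (of_real b') = K a' (of_real b')" if "Re a' > 0" for a' and b' :: real
  proof -
    have "J a' (of_real b') - K a' (of_real b') = 0"
    proof (rule analytic_continuation[where S="{z. Re z > 0}" and U="of_real ` {x::real. x > 0}" and \<xi>=1
          and f="\<lambda>a. J a (of_real b') - K a (of_real b')"])
      show "(\<lambda>a. J a (of_real b') - K a (of_real b')) holomorphic_on {z. Re z > 0}"
        unfolding K_def using pos by (intro holomorphic_intros hol_a) auto
      show "open {z. 0 < Re z}" by (simp add: open_halfspace_Re_gt)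
      show "connected {z. 0 < Re z}" by (simp add: convex_halfspace_Re_gt convex_connected)
    qed (use that lim in \<open>auto simp: real_case\<close>)
    thus ?thesis by simp
  qed
  have "J a b - K a b = 0"
  proof (rule analytic_continuation[where S=UNIV and U="of_real ` {x::real. x > 0}" and \<xi>=1
        and f="\<lambda>b. J a b - K a b"])
    show "(\<lambda>b. J a b - K a b) holomorphic_on UNIV"
      unfolding K_def using pos[of a] a by (intro holomorphic_intros hol_b) auto
  qed (use lim a in \<open>auto simp: step_a\<close>)
  thus ?thesis by (simp add: J_def K_def)
qed

section \<open>Product functions and Gaussians on R^n\<close>

lemma Basis_vec_eq_range: "(Basis :: (real^'n::finite) set) = range (\<lambda>k. axis k 1)"
  by (auto simp: Basis_vec_def)

text \<open>Lebesgue measure is the image of a product measure indexed by basis vectors, not by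
  coordinates. The factors are therefore reindexed along the injection
  \<open>k \<mapsto> axis k 1\<close>, which \<open>i\<close> inverts.\<close>

lemma
  fixes f :: "'n::finite \<Rightarrow> real \<Rightarrow> complex"
  assumes f: "\<And>k. integrable lborel (f k)"
  shows integrable_lborel_vec_prod: "integrable lborel (\<lambda>x::real^'n. \<Prod>k\<in>UNIV. f k (x $ k))" (is ?I)
    and integral_lborel_vec_prod: "(\<integral>x. (\<Prod>k\<in>UNIV. f k ((x::real^'n) $ k)) \<partial>lborel) = (\<Prod>k\<in>UNIV. \<integral>x. f k x \<partial>lborel)" (is ?E)
proof -
  interpret product_sigma_finite "\<lambda>_::real^'n. lborel :: real measure" ..
  define i where "i = inv (\<lambda>k::'n. axis k (1::real))"
  have inj: "inj (\<lambda>k::'n. axis k (1::real))" by (auto simp: inj_on_def axis_eq_axis)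
  have i: "i (axis k 1) = k" for k unfolding i_def using inj by (rule inv_f_f)
  have comp: "(\<Sum>b\<in>Basis. \<omega> b *\<^sub>R b) $ k = \<omega> (axis k 1)" for \<omega> :: "real^'n \<Rightarrow> real" and k
  proof -
    have "(\<Sum>b\<in>Basis. \<omega> b *\<^sub>R b) $ k = (\<Sum>b\<in>Basis. \<omega> b *\<^sub>R b) \<bullet> axis k 1"
      by (simp add: inner_axis)
    also have "\<dots> = \<omega> (axis k 1)"
      by (rule inner_sum_left_Basis) (simp add: axis_in_Basis_iff)
    finally show ?thesis .
  qed
  have eq: "(\<Prod>k\<in>UNIV. f k ((\<Sum>b\<in>Basis. \<omega> b *\<^sub>R b) $ k)) = (\<Prod>b\<in>Basis. f (i b) (\<omega> b))" for \<omega> :: "real^'n \<Rightarrow> real"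
    unfolding comp unfolding Basis_vec_eq_range by (subst prod.reindex[OF inj]) (simp add: i)
  have f_meas [measurable]: "f k \<in> borel_measurable borel" for k
    using borel_measurable_integrable[OF f[of k]] by simp
  have int: "integrable (\<Pi>\<^sub>M b\<in>Basis. lborel) (\<lambda>\<omega>. \<Prod>b\<in>(Basis :: (real^'n) set). f (i b) (\<omega> b))"
    by (intro product_integrable_prod f) simp
  show ?I
    by (subst lborel_eq) (simp add: integrable_distr_eq eq int del: sum_component vector_scaleR_component)
  have "(\<integral>x. (\<Prod>k\<in>UNIV. f k ((x::real^'n) $ k)) \<partial>lborel)
      = (\<integral>\<omega>. (\<Prod>b\<in>(Basis :: (real^'n) set). f (i b) (\<omega> b)) \<partial>(\<Pi>\<^sub>M b\<in>Basis. lborel))"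
    by (subst lborel_eq) (simp add: integral_distr eq del: sum_component vector_scaleR_component)
  also have "\<dots> = (\<Prod>b\<in>(Basis :: (real^'n) set). \<integral>x. f (i b) x \<partial>lborel)"
    by (intro product_integral_prod f) simp
  also have "\<dots> = (\<Prod>k\<in>UNIV. \<integral>x. f k x \<partial>lborel)"
    unfolding Basis_vec_eq_range by (subst prod.reindex[OF inj]) (simp add: i)
  finally show ?E .
qed

lemma
  fixes a b :: "'n::finite \<Rightarrow> complex"
  assumes a: "\<And>k. Re (a k) > 0"
  shows integrable_complex_gaussian_vec:
      "integrable lborel (\<lambda>x::real^'n. exp (\<Sum>k\<in>UNIV. - a k * of_real ((x $ k)\<^sup>2) + b k * of_real (x $ k)))"
    and complex_gaussian_integral_vec:
      "(\<integral>x. exp (\<Sum>k\<in>UNIV. - a k * of_real (((x::real^'n) $ k)\<^sup>2) + b k * of_real (x $ k)) \<partial>lborel)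
       = (\<Prod>k\<in>UNIV. csqrt (of_real pi / a k) * exp ((b k)\<^sup>2 / (4 * a k)))"
  using integrable_lborel_vec_prod[where f="\<lambda>k x. exp (- a k * of_real (x\<^sup>2) + b k * of_real x)"]
    integral_lborel_vec_prod[where f="\<lambda>k x. exp (- a k * of_real (x\<^sup>2) + b k * of_real x)"]
    integrable_complex_gaussian[OF a] complex_gaussian_integral[OF a]
  by (simp_all add: exp_sum)

lemma has_bochner_integral_gaussian_vec:
  fixes a b :: "'n::finite \<Rightarrow> real"
  assumes a: "\<And>k. a k > 0"
  shows "has_bochner_integral lborel (\<lambda>x::real^'n. exp (\<Sum>k\<in>UNIV. - a k * (x $ k)\<^sup>2 + b k * x $ k))
    (\<Prod>k\<in>UNIV. sqrt (pi / a k) * exp ((b k)\<^sup>2 / (4 * a k)))"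
proof -
  have "has_bochner_integral lborel (\<lambda>x::real^'n. complex_of_real (exp (\<Sum>k\<in>UNIV. - a k * (x $ k)\<^sup>2 + b k * x $ k)))
    (complex_of_real (\<Prod>k\<in>UNIV. sqrt (pi / a k) * exp ((b k)\<^sup>2 / (4 * a k))))"
  proof -
    have "complex_of_real (\<Prod>k\<in>UNIV. sqrt (pi / a k) * exp ((b k)\<^sup>2 / (4 * a k)))
        = (\<Prod>k\<in>UNIV. csqrt (of_real pi / of_real (a k)) * exp ((of_real (b k))\<^sup>2 / (4 * of_real (a k))))"
      unfolding of_real_prod
    proof (intro prod.cong refl)
      fix k
      show "complex_of_real (sqrt (pi / a k) * exp ((b k)\<^sup>2 / (4 * a k)))
          = csqrt (of_real pi / of_real (a k)) * exp ((of_real (b k))\<^sup>2 / (4 * of_real (a k)))"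
        using a[of k] csqrt_of_real_nonneg[of "pi / a k"] by (simp flip: exp_of_real)
    qed
    moreover have "complex_of_real (exp (\<Sum>k\<in>UNIV. - a k * (x $ k)\<^sup>2 + b k * x $ k))
      = exp (\<Sum>k\<in>UNIV. - of_real (a k) * of_real ((x $ k)\<^sup>2) + of_real (b k) * of_real (x $ k))" for x :: "real^'n"
      by (simp flip: exp_of_real)
    ultimately show ?thesis
      using integrable_complex_gaussian_vec[of "\<lambda>k. of_real (a k)" "\<lambda>k. of_real (b k)"]
        complex_gaussian_integral_vec[of "\<lambda>k. of_real (a k)" "\<lambda>k. of_real (b k)"] a
      by (simp add: has_bochner_integral_iff)
  qed
  thus ?thesis
    unfolding has_bochner_integral_iff complex_of_real_integrable_eq integral_complex_of_real of_real_eq_iff .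
qed

lemma integrable_gaussian_vec:
  fixes b :: "'n::finite \<Rightarrow> real"
  assumes "a > 0"
  shows "integrable lborel (\<lambda>x::real^'n. exp (- a * (norm x)\<^sup>2 + (\<Sum>k\<in>UNIV. b k * x $ k)))"
  using has_bochner_integral_gaussian_vec[of "\<lambda>_. a" b] assms
  by (simp add: has_bochner_integral_iff sum.distrib norm_vec_def L2_set_def sum_nonneg sum_distrib_left sum_negf sum_subtractf)

section \<open>Fourier transforms of integrable functions\<close>

lemma norm_vec_sq: "(norm (x :: real^'n::finite))\<^sup>2 = (\<Sum>k\<in>UNIV. (x $ k)\<^sup>2)"
  by (simp add: norm_vec_def L2_set_def sum_nonneg)

lemma
  fixes f g :: "_ \<Rightarrow> complex"
  assumes f: "integrable lborel f" and g: "integrable lborel g"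
  shows integrable_lborel_pair_mult: "integrable (lborel \<Otimes>\<^sub>M lborel) (\<lambda>(x, y). f x * g y)" (is ?I)
    and integral_lborel_pair_mult: "(\<integral>(x, y). f x * g y \<partial>(lborel \<Otimes>\<^sub>M lborel)) = (\<integral>x. f x \<partial>lborel) * (\<integral>y. g y \<partial>lborel)" (is ?E)
proof -
  have [measurable]: "f \<in> borel_measurable borel" "g \<in> borel_measurable borel"
    using borel_measurable_integrable[OF f] borel_measurable_integrable[OF g] by simp_all
  show I: ?I
  proof (rule lborel_pair.Fubini_integrable)
    show "integrable lborel (\<lambda>x. \<integral>y. norm (case (x, y) of (x, y) \<Rightarrow> f x * g y) \<partial>lborel)"
      using f by (simp add: norm_mult)
    show "AE x in lborel. integrable lborel (\<lambda>y. case (x, y) of (x, y) \<Rightarrow> f x * g y)"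
      using g by simp
  qed simp
  show ?E
    by (subst lborel_pair.integral_fst'[OF I, symmetric]) simp
qed

text \<open>Each coordinate has its own frequency because the kernel operator has
  \<open>- lam / sin (\<theta> k)\<close> in coordinate \<open>k\<close>; the Bargmann transform has
  the constant \<open>lam\<close>. Without a normalising factor in \<open>fourier\<close>,
  Plancherel's constant is the product of the \<open>2 * pi / \<bar>c k\<bar>\<close>.\<close>

definition wave :: "('n::finite \<Rightarrow> real) \<Rightarrow> real^'n \<Rightarrow> real^'n \<Rightarrow> complex" where
  "wave c x y = exp (\<i> * of_real (\<Sum>k\<in>UNIV. c k * x $ k * y $ k))"

definition fourier :: "('n::finite \<Rightarrow> real) \<Rightarrow> (real^'n \<Rightarrow> complex) \<Rightarrow> real^'n \<Rightarrow> complex" where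
  "fourier c g x = (\<integral>y. wave c x y * g y \<partial>lborel)"

lemma norm_wave [simp]: "norm (wave c x y) = 1"
  by (simp add: wave_def)

lemma borel_measurable_vec_nth_comp [measurable (raw)]:
  fixes f :: "'a \<Rightarrow> 'b::euclidean_space ^ 'n::finite"
  assumes [measurable]: "f \<in> borel_measurable M"
  shows "(\<lambda>p. f p $ k) \<in> borel_measurable M"
proof -
  have [measurable]: "(\<lambda>x::'b^'n. x $ k) \<in> borel_measurable borel"
    by (intro borel_measurable_continuous_onI continuous_intros)
  show ?thesis by measurable
qed

lemma borel_measurable_cnj [measurable (raw)]:
  assumes [measurable]: "f \<in> borel_measurable M"
  shows "(\<lambda>p. cnj (f p)) \<in> borel_measurable M"
proof -
  have [measurable]: "cnj \<in> borel_measurable borel"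
    by (intro borel_measurable_continuous_onI continuous_intros)
  show ?thesis by measurable
qed

lemma borel_measurable_wave [measurable (raw)]:
  assumes [measurable]: "f \<in> borel_measurable M" "g \<in> borel_measurable M"
  shows "(\<lambda>p. wave c (f p) (g p)) \<in> borel_measurable M"
  unfolding wave_def by measurable

lemma wave_diff: "wave c x (y - y') = wave c x y * cnj (wave c x y')"
  by (simp add: wave_def exp_cnj algebra_simps sum_subtractf flip: exp_add)

lemma integrable_wave_mult:
  assumes "integrable lborel g"
  shows "integrable lborel (\<lambda>y. wave c x y * g y)"
proof (rule Bochner_Integration.integrable_bound[OF assms])
  show "(\<lambda>y. wave c x y * g y) \<in> borel_measurable lborel"
    using borel_measurable_integrable[OF assms] by measurable
qed (simp add: norm_mult)

lemma borel_measurable_fourier [measurable]: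
  assumes [measurable]: "g \<in> borel_measurable borel"
  shows "fourier c g \<in> borel_measurable borel"
  unfolding fourier_def by measurable

lemma gaussian_fourier:
  fixes y :: "real^'n::finite"
  assumes e: "e > 0"
  shows "(\<integral>x. wave c x y * of_real (exp (- e * (norm x)\<^sup>2)) \<partial>lborel)
    = of_real (sqrt (pi / e) ^ CARD('n) * exp (- (\<Sum>k\<in>UNIV. (c k * y $ k)\<^sup>2) / (4 * e)))"
proof -
  have "wave c x y * of_real (exp (- e * (norm x)\<^sup>2)) =
    exp (\<Sum>k\<in>UNIV. - of_real e * of_real ((x $ k)\<^sup>2) + (\<i> * of_real (c k * y $ k)) * of_real (x $ k))" for x
    unfolding wave_def norm_vec_sq exp_of_real[symmetric] exp_add[symmetric]
    by (simp add: sum_distrib_left algebra_simps sum.distrib sum_negf sum_subtractf)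
  hence "(\<integral>x. wave c x y * of_real (exp (- e * (norm x)\<^sup>2)) \<partial>lborel) =
    (\<Prod>k\<in>UNIV. csqrt (of_real pi / of_real e) * exp ((\<i> * of_real (c k * y $ k))\<^sup>2 / (4 * of_real e)))"
    using e by (simp only: complex_gaussian_integral_vec Re_complex_of_real)
  also have "\<dots> = (\<Prod>k\<in>UNIV. of_real (sqrt (pi / e) * exp (- (c k * y $ k)\<^sup>2 / (4 * e))))"
  proof (intro prod.cong refl)
    fix k
    have "csqrt (of_real pi / of_real e) = of_real (sqrt (pi / e))"
      using e csqrt_of_real_nonneg[of "pi / e"] by simp
    thus "csqrt (of_real pi / of_real e) * exp ((\<i> * of_real (c k * y $ k))\<^sup>2 / (4 * of_real e))
        = of_real (sqrt (pi / e) * exp (- (c k * y $ k)\<^sup>2 / (4 * e)))"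
      by (simp add: power_mult_distrib flip: exp_of_real)
  qed
  also have "\<dots> = of_real (sqrt (pi / e) ^ CARD('n) * exp (- (\<Sum>k\<in>UNIV. (c k * y $ k)\<^sup>2) / (4 * e)))"
    by (simp add: prod.distrib exp_sum[symmetric] sum_negf sum_divide_distrib flip: of_real_prod)
  finally show ?thesis .
qed

section \<open>The Plancherel inequality\<close>

lemma integrable_gaussian:
  "e > 0 \<Longrightarrow> integrable lborel (\<lambda>x::real^'n::finite. exp (- e * (norm x)\<^sup>2))"
  using integrable_gaussian_vec[of e "\<lambda>_. 0"] by simp

text \<open>The integrand is the value of \<open>gaussian_fourier\<close> at \<open>y - y'\<close>.
  Its mass is free of \<open>e\<close>: in coordinate \<open>k\<close> the height
  \<open>sqrt (pi / e)\<close> meets the width \<open>2 * sqrt (pi * e) / \<bar>c k\<bar>\<close>.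
  This is what lets the regularisation be removed later.\<close>

lemma shifted_gaussian_integral:
  fixes y :: "real^'n::finite"
  assumes e: "e > 0" and c: "\<And>k. c k \<noteq> 0"
  shows "has_bochner_integral lborel (\<lambda>y'. sqrt (pi / e) ^ CARD('n) * exp (- (\<Sum>k\<in>UNIV. (c k * (y - y') $ k)\<^sup>2) / (4 * e)))
    (\<Prod>k\<in>UNIV. 2 * pi / \<bar>c k\<bar>)"
proof -
  let ?a = "\<lambda>k. (c k)\<^sup>2 / (4 * e)" and ?b = "\<lambda>k. (c k)\<^sup>2 * y $ k / (2 * e)"
  let ?K = "sqrt (pi / e) ^ CARD('n) * exp (\<Sum>k\<in>UNIV. - (c k * y $ k)\<^sup>2 / (4 * e))"
  have "has_bochner_integral lborel (\<lambda>x::real^'n. ?K * exp (\<Sum>k\<in>UNIV. - ?a k * (x $ k)\<^sup>2 + ?b k * x $ k))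
    (?K * (\<Prod>k\<in>UNIV. sqrt (pi / ?a k) * exp ((?b k)\<^sup>2 / (4 * ?a k))))"
    using e c by (intro has_bochner_integral_mult_right has_bochner_integral_gaussian_vec) auto
  moreover have "?K * exp (\<Sum>k\<in>UNIV. - ?a k * (x $ k)\<^sup>2 + ?b k * x $ k)
    = sqrt (pi / e) ^ CARD('n) * exp (- (\<Sum>k\<in>UNIV. (c k * (y - x) $ k)\<^sup>2) / (4 * e))" for x
  proof -
    have "(\<Sum>k\<in>UNIV. - (c k * y $ k)\<^sup>2 / (4 * e)) + (\<Sum>k\<in>UNIV. - ?a k * (x $ k)\<^sup>2 + ?b k * x $ k)
      = - (\<Sum>k\<in>UNIV. (c k * (y - x) $ k)\<^sup>2) / (4 * e)"
      unfolding sum.distrib[symmetric] sum_negf[symmetric] sum_divide_distrib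
      using e by (intro sum.cong refl) (simp add: field_simps power2_eq_square)
    thus ?thesis by (simp add: mult.assoc flip: exp_add)
  qed
  moreover have "?K * (\<Prod>k\<in>UNIV. sqrt (pi / ?a k) * exp ((?b k)\<^sup>2 / (4 * ?a k))) = (\<Prod>k\<in>UNIV. 2 * pi / \<bar>c k\<bar>)"
  proof -
    have "?K * (\<Prod>k\<in>UNIV. sqrt (pi / ?a k) * exp ((?b k)\<^sup>2 / (4 * ?a k)))
      = (\<Prod>k\<in>UNIV. sqrt (pi / e) * exp (- (c k * y $ k)\<^sup>2 / (4 * e)) * (sqrt (pi / ?a k) * exp ((?b k)\<^sup>2 / (4 * ?a k))))"
      by (simp add: exp_sum prod.distrib)
    also have "\<dots> = (\<Prod>k\<in>UNIV. 2 * pi / \<bar>c k\<bar>)"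
    proof (intro prod.cong refl)
      fix k
      have "sqrt (pi / e) * sqrt (pi / ?a k) = sqrt ((2 * pi / \<bar>c k\<bar>)\<^sup>2)"
        unfolding real_sqrt_mult[symmetric] using e c[of k] by (simp add: field_simps power2_eq_square)
      hence 1: "sqrt (pi / e) * sqrt (pi / ?a k) = 2 * pi / \<bar>c k\<bar>" by simp
      have 2: "exp (- (c k * y $ k)\<^sup>2 / (4 * e)) * exp ((?b k)\<^sup>2 / (4 * ?a k)) = 1"
        unfolding exp_add[symmetric] using e c[of k] by (simp add: field_simps power2_eq_square)
      have "sqrt (pi / e) * exp (- (c k * y $ k)\<^sup>2 / (4 * e)) * (sqrt (pi / ?a k) * exp ((?b k)\<^sup>2 / (4 * ?a k)))
        = (sqrt (pi / e) * sqrt (pi / ?a k)) * (exp (- (c k * y $ k)\<^sup>2 / (4 * e)) * exp ((?b k)\<^sup>2 / (4 * ?a k)))"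
        by (simp only: mult_ac)
      thus "sqrt (pi / e) * exp (- (c k * y $ k)\<^sup>2 / (4 * e)) * (sqrt (pi / ?a k) * exp ((?b k)\<^sup>2 / (4 * ?a k))) = 2 * pi / \<bar>c k\<bar>"
        unfolding 1 2 by simp
    qed
    finally show ?thesis .
  qed
  ultimately show ?thesis by (simp only:)
qed

text \<open>Expanding the squared modulus of \<open>fourier c g x\<close> as a double integral over
  y and y' leaves one wave in the difference y - y'. The Gaussian weight makes the triple integral
  absolutely convergent, so x can be integrated first. This yields a nonnegative symmetric kernel
  \<gamma> with the same mass in either variable, to which Schur's test applies. As \<open>g\<close>
  is only assumed integrable, the right-hand side may be infinite, so the final estimates live in
  \<open>ennreal\<close>.\<close>

lemma regularised_plancherel_le:
  fixes g :: "real^'n::finite \<Rightarrow> complex"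
  assumes e: "e > 0" and c: "\<And>k. c k \<noteq> 0" and g: "integrable lborel g"
  shows "(\<integral>\<^sup>+x. ennreal ((norm (fourier c g x))\<^sup>2 * exp (- e * (norm x)\<^sup>2)) \<partial>lborel)
    \<le> ennreal (\<Prod>k\<in>UNIV. 2 * pi / \<bar>c k\<bar>) * (\<integral>\<^sup>+y. ennreal ((norm (g y))\<^sup>2) \<partial>lborel)"
proof -
  let ?LL = "lborel \<Otimes>\<^sub>M lborel :: ((real^'n) \<times> (real^'n)) measure"
  let ?C = "\<Prod>k\<in>UNIV. 2 * pi / \<bar>c k\<bar>"
  have [measurable]: "g \<in> borel_measurable borel"
    using borel_measurable_integrable[OF g] by simp
  define G where "G = (\<lambda>(y, y'). g y * cnj (g y'))"
  define \<gamma> where "\<gamma> = (\<lambda>y y'::real^'n. sqrt (pi / e) ^ CARD('n) * exp (- (\<Sum>k\<in>UNIV. (c k * (y - y') $ k)\<^sup>2) / (4 * e)))"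
  have [measurable]: "case_prod \<gamma> \<in> borel_measurable (borel \<Otimes>\<^sub>M borel)" unfolding \<gamma>_def by measurable
  have \<gamma>0: "\<gamma> y y' \<ge> 0" for y y' unfolding \<gamma>_def using e by simp
  have \<gamma>_sym: "\<gamma> y y' = \<gamma> y' y" for y y'
    unfolding \<gamma>_def by (simp add: power_mult_distrib power2_commute)
  have g_cnj: "integrable lborel (\<lambda>y. cnj (g y))" using g by simp
  have G: "integrable ?LL G"
    unfolding G_def by (rule integrable_lborel_pair_mult[OF g g_cnj])
  have [measurable]: "G \<in> borel_measurable (borel \<Otimes>\<^sub>M borel)" unfolding G_def by measurable
  have sq: "of_real ((norm (fourier c g x))\<^sup>2) = (\<integral>p. wave c x (fst p - snd p) * G p \<partial>?LL)" for x
  proof -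
    have "of_real ((norm (fourier c g x))\<^sup>2) = fourier c g x * cnj (fourier c g x)"
      by (rule complex_norm_square)
    also have "\<dots> = (\<integral>y. wave c x y * g y \<partial>lborel) * (\<integral>y. cnj (wave c x y * g y) \<partial>lborel)"
      unfolding fourier_def by (simp only: Bochner_Integration.integral_cnj)
    also have "\<dots> = (\<integral>(y, y'). (wave c x y * g y) * cnj (wave c x y' * g y') \<partial>?LL)"
      using integrable_wave_mult[OF g, of c x]
      by (intro integral_lborel_pair_mult[symmetric] integrable_cnj)
    also have "\<dots> = (\<integral>p. wave c x (fst p - snd p) * G p \<partial>?LL)"
      by (intro Bochner_Integration.integral_cong) (auto simp: G_def wave_diff)
    finally show ?thesis .
  qed
  have int: "integrable (lborel \<Otimes>\<^sub>M ?LL) (\<lambda>(x, p). (of_real (exp (- e * (norm x)\<^sup>2)) * G p) * wave c x (fst p - snd p))"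
  proof (rule Bochner_Integration.integrable_bound)
    have "integrable lborel (\<lambda>x::real^'n. complex_of_real (exp (- e * (norm x)\<^sup>2)))"
      using integrable_gaussian[OF e] by (simp add: complex_of_real_integrable_eq)
    thus "integrable (lborel \<Otimes>\<^sub>M ?LL) (\<lambda>(x::real^'n, p). complex_of_real (exp (- e * (norm x)\<^sup>2)) * G p)"
      using G unfolding lborel_prod by (intro integrable_lborel_pair_mult[unfolded lborel_prod])
    show "AE x in lborel \<Otimes>\<^sub>M ?LL. norm (case x of (x, p) \<Rightarrow> complex_of_real (exp (- e * (norm x)\<^sup>2)) * G p * wave c x (fst p - snd p))
      \<le> norm (case x of (x, p) \<Rightarrow> complex_of_real (exp (- e * (norm x)\<^sup>2)) * G p)"
      by (intro AE_I2) (auto simp: norm_mult)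
  qed measurable
  have step: "complex_of_real ((norm (fourier c g x))\<^sup>2 * exp (- e * (norm x)\<^sup>2))
    = (\<integral>p. (of_real (exp (- e * (norm x)\<^sup>2)) * G p) * wave c x (fst p - snd p) \<partial>?LL)" for x
  proof -
    have "(\<integral>p. (of_real (exp (- e * (norm x)\<^sup>2)) * G p) * wave c x (fst p - snd p) \<partial>?LL)
      = (\<integral>p. of_real (exp (- e * (norm x)\<^sup>2)) * (wave c x (fst p - snd p) * G p) \<partial>?LL)"
      by (intro Bochner_Integration.integral_cong) (auto simp: mult_ac)
    also have "\<dots> = of_real (exp (- e * (norm x)\<^sup>2)) * of_real ((norm (fourier c g x))\<^sup>2)"
      unfolding sq by (rule integral_mult_right_zero)
    also have "\<dots> = complex_of_real ((norm (fourier c g x))\<^sup>2 * exp (- e * (norm x)\<^sup>2))"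
      by (simp add: mult.commute)
    finally show ?thesis by (rule sym)
  qed
  have fint: "integrable lborel (\<lambda>x. complex_of_real ((norm (fourier c g x))\<^sup>2 * exp (- e * (norm x)\<^sup>2)))"
  proof -
    interpret pair_sigma_finite "lborel :: (real^'n) measure" ?LL ..
    have "integrable lborel (\<lambda>x. \<integral>p. (of_real (exp (- e * (norm x)\<^sup>2)) * G p) * wave c x (fst p - snd p) \<partial>?LL)"
      using integrable_fst'[OF int] by simp
    thus ?thesis
      by (simp only: step)
  qed
  have "complex_of_real (\<integral>x. (norm (fourier c g x))\<^sup>2 * exp (- e * (norm x)\<^sup>2) \<partial>lborel)
    = (\<integral>x. (\<integral>p. (of_real (exp (- e * (norm x)\<^sup>2)) * G p) * wave c x (fst p - snd p) \<partial>?LL) \<partial>lborel)"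
    unfolding integral_complex_of_real[symmetric]
    by (simp only: step)
  also have "\<dots> = (\<integral>p. (\<integral>x. (of_real (exp (- e * (norm x)\<^sup>2)) * G p) * wave c x (fst p - snd p) \<partial>lborel) \<partial>?LL)"
  proof -
    interpret pair_sigma_finite "lborel :: (real^'n) measure" ?LL ..
    show ?thesis using Fubini_integral[of "\<lambda>x p. (of_real (exp (- e * (norm x)\<^sup>2)) * G p) * wave c x (fst p - snd p)"] int by simp
  qed
  also have "\<dots> = (\<integral>p. G p * of_real (\<gamma> (fst p) (snd p)) \<partial>?LL)"
  proof (intro Bochner_Integration.integral_cong refl)
    fix p :: "(real^'n) \<times> (real^'n)"
    have "(\<integral>x. (of_real (exp (- e * (norm x)\<^sup>2)) * G p) * wave c x (fst p - snd p) \<partial>lborel)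
      = G p * (\<integral>x. wave c x (fst p - snd p) * of_real (exp (- e * (norm x)\<^sup>2)) \<partial>lborel)"
      unfolding integral_mult_right_zero[symmetric]
      by (intro Bochner_Integration.integral_cong) (auto simp: mult_ac)
    thus "(\<integral>x. (of_real (exp (- e * (norm x)\<^sup>2)) * G p) * wave c x (fst p - snd p) \<partial>lborel) = G p * of_real (\<gamma> (fst p) (snd p))"
      unfolding gaussian_fourier[OF e] \<gamma>_def .
  qed
  finally have eq: "complex_of_real (\<integral>x. (norm (fourier c g x))\<^sup>2 * exp (- e * (norm x)\<^sup>2) \<partial>lborel)
    = (\<integral>p. G p * of_real (\<gamma> (fst p) (snd p)) \<partial>?LL)" .
  have I: "(\<integral>\<^sup>+y'. ennreal (\<gamma> y y') \<partial>lborel) = ennreal ?C" for y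
  proof -
    have "has_bochner_integral lborel (\<gamma> y) ?C"
      unfolding \<gamma>_def by (rule shifted_gaussian_integral[OF e c])
    thus ?thesis using \<gamma>0 by (subst nn_integral_eq_integral) (auto simp: has_bochner_integral_iff)
  qed
  have "(\<integral>\<^sup>+x. ennreal ((norm (fourier c g x))\<^sup>2 * exp (- e * (norm x)\<^sup>2)) \<partial>lborel)
    = ennreal (\<integral>x. (norm (fourier c g x))\<^sup>2 * exp (- e * (norm x)\<^sup>2) \<partial>lborel)"
    using fint by (intro nn_integral_eq_integral) (simp_all only: complex_of_real_integrable_eq, auto)
  also have "\<dots> = ennreal (norm (\<integral>p. G p * of_real (\<gamma> (fst p) (snd p)) \<partial>?LL))"
    unfolding eq[symmetric] norm_of_real by (subst abs_of_nonneg) (auto intro!: Bochner_Integration.integral_nonneg)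
  \<comment> \<open>Were the product not integrable, its Bochner integral would be 0 by convention,
    so the bound holds either way.\<close>
  also have "\<dots> \<le> (\<integral>\<^sup>+p. ennreal (norm (G p * of_real (\<gamma> (fst p) (snd p)))) \<partial>?LL)"
    by (cases "integrable ?LL (\<lambda>p. G p * of_real (\<gamma> (fst p) (snd p)))")
      (auto intro!: integral_norm_bound_ennreal simp: not_integrable_integral_eq)
  \<comment> \<open>Schur's test: \<open>u * v \<le> u^2 / 2 + v^2 / 2\<close>, where each square
    keeps the copy of \<gamma> whose second argument is the other variable, ready to be integrated
    out.\<close>
  also have "\<dots> \<le> (\<integral>\<^sup>+p. ennreal (1 / 2) * (ennreal ((norm (g (fst p)))\<^sup>2) * ennreal (\<gamma> (fst p) (snd p)))
      + ennreal (1 / 2) * (ennreal ((norm (g (snd p)))\<^sup>2) * ennreal (\<gamma> (snd p) (fst p))) \<partial>?LL)"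
  proof (intro nn_integral_mono)
    fix p :: "(real^'n) \<times> (real^'n)"
    let ?u = "norm (g (fst p))" and ?v = "norm (g (snd p))" and ?w = "\<gamma> (fst p) (snd p)"
    have "?u * ?v \<le> 1 / 2 * ?u\<^sup>2 + 1 / 2 * ?v\<^sup>2"
      using sum_squares_bound[of ?u ?v] by simp
    hence "?u * ?v * ?w \<le> 1 / 2 * (?u\<^sup>2 * ?w) + 1 / 2 * (?v\<^sup>2 * ?w)"
      using \<gamma>0[of "fst p" "snd p"] mult_right_mono by (fastforce simp: algebra_simps)
    moreover have "norm (G p * of_real ?w) = ?u * ?v * ?w"
      using \<gamma>0[of "fst p" "snd p"] by (cases p) (simp add: G_def norm_mult)
    ultimately show "ennreal (norm (G p * of_real ?w)) \<le> ennreal (1 / 2) * (ennreal (?u\<^sup>2) * ennreal ?w)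
      + ennreal (1 / 2) * (ennreal (?v\<^sup>2) * ennreal (\<gamma> (snd p) (fst p)))"
      unfolding \<gamma>_sym[of "snd p" "fst p"] using \<gamma>0[of "fst p" "snd p"]
      by (simp flip: ennreal_mult ennreal_plus del: ennreal_half)
  qed
  also have "\<dots> = ennreal (1 / 2) * (\<integral>\<^sup>+p. ennreal ((norm (g (fst p)))\<^sup>2) * ennreal (\<gamma> (fst p) (snd p)) \<partial>?LL)
      + ennreal (1 / 2) * (\<integral>\<^sup>+p. ennreal ((norm (g (snd p)))\<^sup>2) * ennreal (\<gamma> (snd p) (fst p)) \<partial>?LL)"
    by (simp add: nn_integral_add nn_integral_cmult)
  also have "(\<integral>\<^sup>+p. ennreal ((norm (g (fst p)))\<^sup>2) * ennreal (\<gamma> (fst p) (snd p)) \<partial>?LL)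
    = (\<integral>\<^sup>+y. (\<integral>\<^sup>+y'. ennreal ((norm (g y))\<^sup>2) * ennreal (\<gamma> y y') \<partial>lborel) \<partial>lborel)"
    by (subst lborel.nn_integral_fst[symmetric]) simp_all
  also have "\<dots> = ennreal ?C * (\<integral>\<^sup>+y. ennreal ((norm (g y))\<^sup>2) \<partial>lborel)"
    by (simp add: nn_integral_cmult nn_integral_multc I mult.commute)
  also have "(\<integral>\<^sup>+p. ennreal ((norm (g (snd p)))\<^sup>2) * ennreal (\<gamma> (snd p) (fst p)) \<partial>?LL)
    = (\<integral>\<^sup>+y'. (\<integral>\<^sup>+y. ennreal ((norm (g y'))\<^sup>2) * ennreal (\<gamma> y' y) \<partial>lborel) \<partial>lborel)"
    by (subst lborel_pair.nn_integral_snd[symmetric]) simp_all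
  also have "\<dots> = ennreal ?C * (\<integral>\<^sup>+y. ennreal ((norm (g y))\<^sup>2) \<partial>lborel)"
    by (simp add: nn_integral_cmult nn_integral_multc I mult.commute)
  also have "ennreal (1 / 2) * (ennreal ?C * (\<integral>\<^sup>+y. ennreal ((norm (g y))\<^sup>2) \<partial>lborel))
      + ennreal (1 / 2) * (ennreal ?C * (\<integral>\<^sup>+y. ennreal ((norm (g y))\<^sup>2) \<partial>lborel))
    = ennreal ?C * (\<integral>\<^sup>+y. ennreal ((norm (g y))\<^sup>2) \<partial>lborel)"
  proof -
    have "ennreal (1 / 2) + ennreal (1 / 2) = 1" by (subst ennreal_plus[symmetric]) auto
    thus ?thesis unfolding distrib_right[symmetric] by simp
  qed
  finally show ?thesis .
qed

text \<open>Fatou's lemma along \<open>e = inverse (real (Suc m))\<close>, since the regularised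
  bound is uniform in \<open>e\<close>.\<close>

lemma plancherel_le:
  fixes g :: "real^'n::finite \<Rightarrow> complex"
  assumes c: "\<And>k. c k \<noteq> 0" and g: "integrable lborel g"
  shows "(\<integral>\<^sup>+x. ennreal ((norm (fourier c g x))\<^sup>2) \<partial>lborel)
    \<le> ennreal (\<Prod>k\<in>UNIV. 2 * pi / \<bar>c k\<bar>) * (\<integral>\<^sup>+y. ennreal ((norm (g y))\<^sup>2) \<partial>lborel)" (is "_ \<le> ?R")
proof -
  let ?u = "\<lambda>m x. ennreal ((norm (fourier c g x))\<^sup>2 * exp (- inverse (real (Suc m)) * (norm x)\<^sup>2))"
  have [measurable]: "g \<in> borel_measurable borel"
    using borel_measurable_integrable[OF g] by simp
  have lim: "(\<lambda>m. ?u m x) \<longlonglongrightarrow> ennreal ((norm (fourier c g x))\<^sup>2)" for x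
  proof (intro tendsto_ennrealI)
    have "(\<lambda>m. (norm (fourier c g x))\<^sup>2 * exp (- inverse (real (Suc m)) * (norm x)\<^sup>2))
      \<longlonglongrightarrow> (norm (fourier c g x))\<^sup>2 * exp (- 0 * (norm x)\<^sup>2)"
      by (intro tendsto_intros LIMSEQ_inverse_real_of_nat)
    thus "(\<lambda>m. (norm (fourier c g x))\<^sup>2 * exp (- inverse (real (Suc m)) * (norm x)\<^sup>2))
      \<longlonglongrightarrow> (norm (fourier c g x))\<^sup>2" by simp
  qed
  have "(\<integral>\<^sup>+x. ennreal ((norm (fourier c g x))\<^sup>2) \<partial>lborel) = (\<integral>\<^sup>+x. liminf (\<lambda>m. ?u m x) \<partial>lborel)"
    by (rule nn_integral_cong, rule sym, rule lim_imp_Liminf[OF trivial_limit_sequentially lim])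
  also have "\<dots> \<le> liminf (\<lambda>m. \<integral>\<^sup>+x. ?u m x \<partial>lborel)"
    by (rule nn_integral_liminf) measurable
  also have "\<dots> \<le> liminf (\<lambda>m::nat. ?R)"
    by (intro Liminf_mono always_eventually allI regularised_plancherel_le c g) simp
  also have "\<dots> = ?R" by (simp add: Liminf_const)
  finally show ?thesis .
qed

section \<open>Uniqueness for integrable functions\<close>

lemma AE_zero_Int_stable:
  fixes h :: "'a::euclidean_space \<Rightarrow> complex"
  assumes h: "integrable lborel h" and G: "Int_stable G" "UNIV \<in> G" "sets borel = sigma_sets UNIV G"
    and zero: "\<And>A. A \<in> G \<Longrightarrow> (LINT x:A|lborel. h x) = 0"
  shows "AE x in lborel. h x = 0"
proof (rule sigma_finite_measure.density_zero[OF lborel.sigma_finite_measure_axioms h])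
  fix A :: "'a set" assume A: "A \<in> sets lborel"
  hence "A \<in> sigma_sets UNIV G" using G by simp
  have G_Pow: "G \<subseteq> Pow UNIV" by simp
  have G_sets: "B \<in> sets borel" if "B \<in> sigma_sets UNIV G" for B
    using that unfolding G(3)[symmetric] by simp
  have h_set: "set_integrable lborel B h" if "B \<in> sigma_sets UNIV G" for B
    using G_sets[OF that] h unfolding set_integrable_def by (simp add: integrable_mult_indicator)
  \<comment> \<open>Dynkin's argument: the sets over which \<open>h\<close> integrates to zero are
    closed under complements, thanks to \<open>UNIV \<in> G\<close>, and under countable disjoint
    unions.\<close>
  show "(LINT x:A|lborel. h x) = 0"
    using G(1) G_Pow \<open>A \<in> sigma_sets UNIV G\<close>
  proof (induction rule: sigma_sets_induct_disjoint)
    case (compl A)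
    have "(LINT x:(UNIV - A) \<union> A|lborel. h x) = (LINT x:UNIV - A|lborel. h x) + (LINT x:A|lborel. h x)"
      using compl(1) by (intro set_integral_Un h_set sigma_sets.Compl) auto
    thus ?case using zero[OF G(2)] compl(2) by simp
  next
    case (union A)
    have "(LINT x:(\<Union>i. A i)|lborel. h x) = (\<Sum>i. LINT x:A i|lborel. h x)"
      using union by (intro lebesgue_integral_countable_add h_set sigma_sets.Union)
        (auto simp: disjoint_family_on_def intro!: G_sets)
    thus ?case using union by simp
  next
    case (basic A)
    thus ?case by (rule zero)
  next
    case empty
    show ?case by (simp add: set_lebesgue_integral_def)
  qed
qed

text \<open>The indicator of an open set U is the pointwise limit of the cut-offs
  \<open>min 1 (k * infdist x (- U))\<close>, and the open sets form an intersection-stable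
  generator of the Borel sets.\<close>

lemma AE_zero_continuous:
  fixes h :: "'a::euclidean_space \<Rightarrow> complex"
  assumes h: "integrable lborel h"
    and zero: "\<And>f :: 'a \<Rightarrow> real. continuous_on UNIV f \<Longrightarrow> (\<And>x. 0 \<le> f x \<and> f x \<le> 1) \<Longrightarrow> (\<integral>x. f x *\<^sub>R h x \<partial>lborel) = 0"
  shows "AE x in lborel. h x = 0"
proof (rule AE_zero_Int_stable[OF h, of "{S. open S}"])
  have [measurable]: "h \<in> borel_measurable borel" using borel_measurable_integrable[OF h] by simp
  show "sets borel = sigma_sets UNIV {S :: 'a set. open S}"
    unfolding borel_def by (simp add: sets_measure_of)
  fix U :: "'a set" assume "U \<in> {S. open S}"
  hence U: "open U" by simp
  show "(LINT x:U|lborel. h x) = 0"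
  \<comment> \<open>\<open>infdist\<close> to the empty set is 0 by convention, so the cut-offs
    would vanish for \<open>U = UNIV\<close>.\<close>
  proof (cases "U = UNIV")
    case True
    thus ?thesis using zero[of "\<lambda>_. 1"] by (simp add: set_lebesgue_integral_def)
  next
    case False
    define f where "f = (\<lambda>(k::nat) x. min 1 (real k * infdist x (- U)))"
    have f0: "(\<integral>x. f k x *\<^sub>R h x \<partial>lborel) = 0" for k
      unfolding f_def by (intro zero continuous_intros) (auto simp: infdist_nonneg)
    have f_cont: "continuous_on UNIV (f k)" for k unfolding f_def by (intro continuous_intros)
    have [measurable]: "f k \<in> borel_measurable borel" for k
      using f_cont by (intro borel_measurable_continuous_onI)
    have [measurable]: "U \<in> sets borel" using U by simp
    have "(\<lambda>k. \<integral>x. f k x *\<^sub>R h x \<partial>lborel) \<longlonglongrightarrow> (\<integral>x. indicator U x *\<^sub>R h x \<partial>lborel)"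
    proof (rule integral_dominated_convergence)
      show "integrable lborel (\<lambda>x. norm (h x))" using h by simp
      show "AE x in lborel. (\<lambda>k. f k x *\<^sub>R h x) \<longlonglongrightarrow> indicator U x *\<^sub>R h x"
      proof (intro AE_I2 tendsto_intros)
        fix x
        show "(\<lambda>k. f k x) \<longlonglongrightarrow> indicator U x"
        proof (cases "x \<in> U")
          case True
          have "infdist x (- U) > 0"
            using True False U by (intro infdist_pos_not_in_closed) auto
          then obtain N where N: "1 < real N * infdist x (- U)" using reals_Archimedean3 by blast
          have "eventually (\<lambda>k. f k x = 1) sequentially"
            using eventually_ge_at_top[of N]
          proof eventually_elim
            case (elim k)
            have "real N * infdist x (- U) \<le> real k * infdist x (- U)"
              using elim by (intro mult_right_mono infdist_nonneg) simp
            thus ?case using N by (simp add: f_def)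
          qed
          thus ?thesis using True by (simp add: tendsto_eventually)
        next
          case False
          thus ?thesis by (simp add: f_def)
        qed
      qed
      show "AE x in lborel. norm (f k x *\<^sub>R h x) \<le> norm (h x)" for k
        by (intro AE_I2) (auto simp: f_def infdist_nonneg intro!: mult_left_le_one_le)
    qed measurable
    moreover have "(\<lambda>k. \<integral>x. f k x *\<^sub>R h x \<partial>lborel) \<longlonglongrightarrow> 0" by (simp add: f0)
    ultimately show ?thesis
      unfolding set_lebesgue_integral_def using LIMSEQ_unique by blast
  qed
qed (auto simp: Int_stable_def)

lemma lborel_integral_affine:
  fixes f :: "'a::euclidean_space \<Rightarrow> 'b::{banach, second_countable_topology}"
  assumes [measurable]: "f \<in> borel_measurable borel" and c: "c \<noteq> 0"
  shows "(\<integral>x. f x \<partial>lborel) = \<bar>c\<bar> ^ DIM('a) *\<^sub>R (\<integral>x. f (t + c *\<^sub>R x) \<partial>lborel)"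
  by (subst lborel_affine[OF c, of t]) (simp add: integral_density integral_distr)

text \<open>If the Fourier transform vanishes, so does every Gaussian average of \<open>h\<close>.
  Moving the averaging onto a test function by Fubini and letting its width tend to 0 shows that
  \<open>h\<close> annihilates the test function itself. The tests are continuous functions damped
  by a Gaussian, which makes them integrable as Fubini requires; the damping is then read as a
  nonvanishing factor of \<open>h\<close>.\<close>

lemma fourier_unique:
  fixes h :: "real^'n::finite \<Rightarrow> complex"
  assumes h: "integrable lborel h" and c: "c \<noteq> 0" and zero: "\<And>x. fourier (\<lambda>_. c) h x = 0"
  shows "AE x in lborel. h x = 0"
proof -
  have [measurable]: "h \<in> borel_measurable borel" using borel_measurable_integrable[OF h] by simp
  have gauss: "integrable lborel (\<lambda>x::real^'n. complex_of_real (exp (- e * (norm x)\<^sup>2)))" if "e > 0" for e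
    using integrable_gaussian[OF that] by (simp add: complex_of_real_integrable_eq)
  have conv0: "(\<integral>y. of_real (exp (- (norm (y - x))\<^sup>2 / e)) * h y \<partial>lborel) = 0" if e: "e > 0" for e and x
  proof -
    \<comment> \<open>Chosen so that the transform of \<open>exp (- e0 * (norm w)^2)\<close>, namely
      a multiple of \<open>exp (- (c * norm y)^2 / (4 * e0))\<close>, has exponent
      \<open>- (norm y)^2 / e\<close>.\<close>
    define e0 where "e0 = c\<^sup>2 * e / 4"
    have e0: "e0 > 0" using e c by (simp add: e0_def)
    let ?K = "complex_of_real (sqrt (pi / e0) ^ CARD('n))"
    have int: "integrable (lborel \<Otimes>\<^sub>M lborel) (\<lambda>(w, y). wave (\<lambda>_. c) w (y - x) * (of_real (exp (- e0 * (norm w)\<^sup>2)) * h y))"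
    proof (rule Bochner_Integration.integrable_bound)
      show "integrable (lborel \<Otimes>\<^sub>M lborel) (\<lambda>(w::real^'n, y). of_real (exp (- e0 * (norm w)\<^sup>2)) * h y)"
        by (rule integrable_lborel_pair_mult[OF gauss[OF e0] h])
      show "AE p in lborel \<Otimes>\<^sub>M lborel. norm (case p of (w, y) \<Rightarrow> wave (\<lambda>_. c) w (y - x) * (of_real (exp (- e0 * (norm w)\<^sup>2)) * h y))
        \<le> norm (case p of (w, y) \<Rightarrow> of_real (exp (- e0 * (norm w)\<^sup>2)) * h y)"
        by (intro AE_I2) (auto simp: norm_mult)
    qed measurable
    have "?K * (\<integral>y. of_real (exp (- (norm (y - x))\<^sup>2 / e)) * h y \<partial>lborel)
      = (\<integral>y. ?K * (of_real (exp (- (norm (y - x))\<^sup>2 / e)) * h y) \<partial>lborel)"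
      by (rule integral_mult_right_zero[symmetric])
    also have "\<dots> = (\<integral>y. (\<integral>w. wave (\<lambda>_. c) w (y - x) * (of_real (exp (- e0 * (norm w)\<^sup>2)) * h y) \<partial>lborel) \<partial>lborel)"
    proof (intro Bochner_Integration.integral_cong refl)
      fix y
      have "(\<integral>w. wave (\<lambda>_. c) w (y - x) * (of_real (exp (- e0 * (norm w)\<^sup>2)) * h y) \<partial>lborel)
        = (\<integral>w. wave (\<lambda>_. c) w (y - x) * of_real (exp (- e0 * (norm w)\<^sup>2)) \<partial>lborel) * h y"
        unfolding mult.assoc[symmetric] by (rule integral_mult_left_zero)
      also have "\<dots> = ?K * of_real (exp (- (norm (y - x))\<^sup>2 / e)) * h y"
      proof -
        have "(\<Sum>k\<in>UNIV. (c * (y - x) $ k)\<^sup>2) / (4 * e0) = (norm (y - x))\<^sup>2 / e"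
          unfolding norm_vec_sq power_mult_distrib sum_distrib_left[symmetric] e0_def
          using c e by (simp add: field_simps)
        thus ?thesis unfolding gaussian_fourier[OF e0] by simp
      qed
      finally show "?K * (of_real (exp (- (norm (y - x))\<^sup>2 / e)) * h y)
        = (\<integral>w. wave (\<lambda>_. c) w (y - x) * (of_real (exp (- e0 * (norm w)\<^sup>2)) * h y) \<partial>lborel)" by simp
    qed
    \<comment> \<open>With y integrated first, the inner integral is a multiple of a value of the
      Fourier transform of \<open>h\<close>.\<close>
    also have "\<dots> = (\<integral>w. (\<integral>y. wave (\<lambda>_. c) w (y - x) * (of_real (exp (- e0 * (norm w)\<^sup>2)) * h y) \<partial>lborel) \<partial>lborel)"
      by (rule lborel_pair.Fubini_integral[OF int])
    also have "\<dots> = (\<integral>w. 0 \<partial>(lborel :: (real^'n) measure))"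
    proof (intro Bochner_Integration.integral_cong refl)
      fix w :: "real^'n"
      have "(\<integral>y. wave (\<lambda>_. c) w (y - x) * (of_real (exp (- e0 * (norm w)\<^sup>2)) * h y) \<partial>lborel)
        = (\<integral>y. (cnj (wave (\<lambda>_. c) w x) * of_real (exp (- e0 * (norm w)\<^sup>2))) * (wave (\<lambda>_. c) w y * h y) \<partial>lborel)"
        by (intro Bochner_Integration.integral_cong refl) (simp add: wave_diff mult_ac)
      also have "\<dots> = (cnj (wave (\<lambda>_. c) w x) * of_real (exp (- e0 * (norm w)\<^sup>2))) * fourier (\<lambda>_. c) h w"
        unfolding fourier_def by (rule integral_mult_right_zero)
      finally show "(\<integral>y. wave (\<lambda>_. c) w (y - x) * (of_real (exp (- e0 * (norm w)\<^sup>2)) * h y) \<partial>lborel) = 0"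
        by (simp add: zero)
    qed
    finally show ?thesis using e0 by simp
  qed
  \<comment> \<open>The averaging Gaussian is not normalised, so its mass \<open>C\<close> stays as
    a factor in the limit and only has to be nonzero.\<close>
  define C where "C = (\<integral>u. exp (- (norm (u::real^'n))\<^sup>2) \<partial>lborel)"
  have C: "C \<noteq> 0"
    using has_bochner_integral_gaussian_vec[of "\<lambda>_::'n. 1" "\<lambda>_. 0"]
    by (simp add: C_def has_bochner_integral_iff norm_vec_sq sum_negf)
  have gauss1: "integrable lborel (\<lambda>u::real^'n. exp (- (norm u)\<^sup>2))"
    using integrable_gaussian[of 1] by simp
  have "AE x in lborel. of_real (exp (- (norm x)\<^sup>2)) * h x = 0"
  proof (rule AE_zero_continuous)
    show "integrable lborel (\<lambda>x. of_real (exp (- (norm x)\<^sup>2)) * h x)"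
      by (rule Bochner_Integration.integrable_bound[OF h]) (auto simp: norm_mult intro!: mult_left_le_one_le)
    fix f :: "real^'n \<Rightarrow> real"
    assume f_cont: "continuous_on UNIV f" and f01: "\<And>x. 0 \<le> f x \<and> f x \<le> 1"
    define f1 where "f1 = (\<lambda>x. f x * exp (- (norm x)\<^sup>2))"
    have f1_cont: "continuous_on UNIV f1" unfolding f1_def by (intro continuous_intros f_cont)
    have [measurable]: "f1 \<in> borel_measurable borel" using f1_cont by (rule borel_measurable_continuous_onI)
    have f1_01: "0 \<le> f1 x" "f1 x \<le> 1" for x
      using f01[of x] by (auto simp: f1_def intro!: mult_le_one)
    have f1_int: "integrable lborel (\<lambda>x. complex_of_real (f1 x))"
    proof (rule Bochner_Integration.integrable_bound[OF gauss1])
      show "AE x in lborel. norm (complex_of_real (f1 x)) \<le> norm (exp (- (norm x)\<^sup>2))"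
        using f01 by (intro AE_I2) (auto simp: f1_def norm_mult intro!: mult_left_le_one_le)
    qed measurable
    \<comment> \<open>The Gaussian average of \<open>f1\<close> at scale \<delta>. In this form the
      scale sits inside the continuous function, so dominated convergence applies; substituting x =
      y + \<delta>u turns it back into a convolution.\<close>
    define \<phi> where "\<phi> = (\<lambda>\<delta> y. \<integral>u. f1 (y + \<delta> *\<^sub>R u) * exp (- (norm u)\<^sup>2) \<partial>lborel)"
    have \<phi>0: "(\<integral>y. of_real (\<phi> \<delta> y) * h y \<partial>lborel) = 0" if d: "\<delta> > 0" for \<delta>
    proof -
      have phi_eq: "(\<integral>x. f1 x * exp (- (norm (y - x))\<^sup>2 / \<delta>\<^sup>2) \<partial>lborel) = \<delta> ^ CARD('n) * \<phi> \<delta> y" for y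
        using d by (subst lborel_integral_affine[where c=\<delta> and t=y]) (simp_all add: \<phi>_def power_mult_distrib)
      have int: "integrable (lborel \<Otimes>\<^sub>M lborel) (\<lambda>(x, y). of_real (exp (- (norm (y - x))\<^sup>2 / \<delta>\<^sup>2)) * (of_real (f1 x) * h y))"
      proof (rule Bochner_Integration.integrable_bound)
        show "integrable (lborel \<Otimes>\<^sub>M lborel) (\<lambda>(x, y). of_real (f1 x) * h y)"
          by (rule integrable_lborel_pair_mult[OF f1_int h])
        show "AE p in lborel \<Otimes>\<^sub>M lborel. norm (case p of (x, y) \<Rightarrow> of_real (exp (- (norm (y - x))\<^sup>2 / \<delta>\<^sup>2)) * (of_real (f1 x) * h y))
          \<le> norm (case p of (x, y) \<Rightarrow> of_real (f1 x) * h y)"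
          by (intro AE_I2) (auto simp: norm_mult intro!: mult_left_le_one_le)
      qed measurable
      have "complex_of_real (\<delta> ^ CARD('n)) * (\<integral>y. of_real (\<phi> \<delta> y) * h y \<partial>lborel)
        = (\<integral>y. of_real (\<delta> ^ CARD('n) * \<phi> \<delta> y) * h y \<partial>lborel)"
        unfolding integral_mult_right_zero[symmetric] of_real_mult by (simp only: mult.assoc)
      also have "\<dots> = (\<integral>y. (\<integral>x. of_real (exp (- (norm (y - x))\<^sup>2 / \<delta>\<^sup>2)) * (of_real (f1 x) * h y) \<partial>lborel) \<partial>lborel)"
      proof (intro Bochner_Integration.integral_cong refl)
        fix y
        have "(\<integral>x. of_real (exp (- (norm (y - x))\<^sup>2 / \<delta>\<^sup>2)) * (of_real (f1 x) * h y) \<partial>lborel)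
          = (\<integral>x. of_real (f1 x * exp (- (norm (y - x))\<^sup>2 / \<delta>\<^sup>2)) * h y \<partial>lborel)"
          by (intro Bochner_Integration.integral_cong refl) simp
        also have "\<dots> = (\<integral>x. of_real (f1 x * exp (- (norm (y - x))\<^sup>2 / \<delta>\<^sup>2)) \<partial>lborel) * h y"
          by (rule integral_mult_left_zero)
        also have "(\<integral>x. complex_of_real (f1 x * exp (- (norm (y - x))\<^sup>2 / \<delta>\<^sup>2)) \<partial>lborel) = of_real (\<delta> ^ CARD('n) * \<phi> \<delta> y)"
          unfolding integral_complex_of_real phi_eq ..
        finally show "of_real (\<delta> ^ CARD('n) * \<phi> \<delta> y) * h y
          = (\<integral>x. of_real (exp (- (norm (y - x))\<^sup>2 / \<delta>\<^sup>2)) * (of_real (f1 x) * h y) \<partial>lborel)" by simp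
      qed
      also have "\<dots> = (\<integral>x. (\<integral>y. of_real (exp (- (norm (y - x))\<^sup>2 / \<delta>\<^sup>2)) * (of_real (f1 x) * h y) \<partial>lborel) \<partial>lborel)"
        by (rule lborel_pair.Fubini_integral[OF int])
      also have "\<dots> = (\<integral>x. 0 \<partial>(lborel :: (real^'n) measure))"
      proof (intro Bochner_Integration.integral_cong refl)
        fix x
        have "(\<integral>y. of_real (exp (- (norm (y - x))\<^sup>2 / \<delta>\<^sup>2)) * (of_real (f1 x) * h y) \<partial>lborel)
          = (\<integral>y. of_real (f1 x) * (of_real (exp (- (norm (y - x))\<^sup>2 / \<delta>\<^sup>2)) * h y) \<partial>lborel)"
          by (intro Bochner_Integration.integral_cong refl) simp
        also have "\<dots> = of_real (f1 x) * (\<integral>y. of_real (exp (- (norm (y - x))\<^sup>2 / \<delta>\<^sup>2)) * h y \<partial>lborel)"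
          by (rule integral_mult_right_zero)
        finally show "(\<integral>y. of_real (exp (- (norm (y - x))\<^sup>2 / \<delta>\<^sup>2)) * (of_real (f1 x) * h y) \<partial>lborel) = 0"
          using conv0[of "\<delta>\<^sup>2" x] d by simp
      qed
      finally show ?thesis using d by simp
    qed
    have f1_mult_int: "integrable lborel (\<lambda>u. f1 (y + \<delta> *\<^sub>R u) * exp (- (norm u)\<^sup>2))" for y \<delta>
      by (rule Bochner_Integration.integrable_bound[OF gauss1])
        (auto simp: abs_mult f1_01 intro!: mult_left_le_one_le)
    have \<phi>_lim: "(\<lambda>m. \<phi> (inverse (real (Suc m))) y) \<longlonglongrightarrow> f1 y * C" for y
    proof -
      have "(\<lambda>m. \<integral>u. f1 (y + inverse (real (Suc m)) *\<^sub>R u) * exp (- (norm u)\<^sup>2) \<partial>lborel)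
        \<longlonglongrightarrow> (\<integral>u. f1 y * exp (- (norm (u::real^'n))\<^sup>2) \<partial>lborel)"
      proof (rule integral_dominated_convergence)
        show "integrable lborel (\<lambda>u::real^'n. exp (- (norm u)\<^sup>2))" by (rule gauss1)
        show "AE u in lborel. (\<lambda>m. f1 (y + inverse (real (Suc m)) *\<^sub>R u) * exp (- (norm u)\<^sup>2)) \<longlonglongrightarrow> f1 y * exp (- (norm u)\<^sup>2)"
        proof (intro AE_I2 tendsto_mult_right)
          fix u
          have "(\<lambda>m. y + inverse (real (Suc m)) *\<^sub>R u) \<longlonglongrightarrow> y + 0 *\<^sub>R u"
            by (intro tendsto_intros LIMSEQ_inverse_real_of_nat)
          hence "(\<lambda>m. y + inverse (real (Suc m)) *\<^sub>R u) \<longlonglongrightarrow> y" by simp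
          moreover have "isCont f1 y" using f1_cont by (simp add: continuous_on_eq_continuous_at)
          ultimately show "(\<lambda>m. f1 (y + inverse (real (Suc m)) *\<^sub>R u)) \<longlonglongrightarrow> f1 y"
            by (rule isCont_tendsto_compose[rotated])
        qed
        show "AE u in lborel. norm (f1 (y + inverse (real (Suc m)) *\<^sub>R u) * exp (- (norm u)\<^sup>2)) \<le> exp (- (norm u)\<^sup>2)" for m
          by (intro AE_I2) (auto simp: abs_mult f1_01 intro!: mult_left_le_one_le)
      qed measurable
      thus ?thesis by (simp add: \<phi>_def C_def)
    qed
    have \<phi>_bound: "\<bar>\<phi> \<delta> y\<bar> \<le> C" for \<delta> y
      unfolding \<phi>_def C_def
    proof (rule order.trans[OF integral_abs_bound integral_mono])
      show "integrable lborel (\<lambda>u. \<bar>f1 (y + \<delta> *\<^sub>R u) * exp (- (norm u)\<^sup>2)\<bar>)"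
        using f1_mult_int by (rule integrable_abs)
    qed (auto simp: abs_mult f1_01 gauss1 intro!: mult_left_le_one_le)
    have [measurable]: "\<phi> \<delta> \<in> borel_measurable borel" for \<delta> unfolding \<phi>_def by measurable
    have "(\<lambda>m. \<integral>y. of_real (\<phi> (inverse (real (Suc m))) y) * h y \<partial>lborel) \<longlonglongrightarrow> (\<integral>y. of_real (f1 y * C) * h y \<partial>lborel)"
    proof (rule integral_dominated_convergence)
      show "integrable lborel (\<lambda>y. C * norm (h y))" using h by simp
      show "AE y in lborel. (\<lambda>m. of_real (\<phi> (inverse (real (Suc m))) y) * h y) \<longlonglongrightarrow> of_real (f1 y * C) * h y"
        by (intro AE_I2 tendsto_mult_right tendsto_of_real \<phi>_lim)
      show "AE y in lborel. norm (of_real (\<phi> (inverse (real (Suc m))) y) * h y) \<le> C * norm (h y)" for m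
        using \<phi>_bound by (intro AE_I2) (simp add: norm_mult mult_right_mono del: of_nat_Suc)
    qed measurable
    hence "(\<lambda>m::nat. 0) \<longlonglongrightarrow> (\<integral>y. of_real (f1 y * C) * h y \<partial>lborel)"
      by (simp add: \<phi>0 del: of_nat_Suc)
    hence "(\<integral>y. of_real (f1 y * C) * h y \<partial>lborel) = 0"
      using LIMSEQ_unique tendsto_const by blast
    moreover have "(\<integral>y. of_real (f1 y * C) * h y \<partial>lborel) = of_real C * (\<integral>y. f y *\<^sub>R (of_real (exp (- (norm y)\<^sup>2)) * h y) \<partial>lborel)"
      unfolding integral_mult_right_zero[symmetric]
      by (intro Bochner_Integration.integral_cong refl) (simp add: f1_def scaleR_conv_of_real)
    ultimately show "(\<integral>x. f x *\<^sub>R (of_real (exp (- (norm x)\<^sup>2)) * h x) \<partial>lborel) = 0"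
      using C by simp
  qed
  thus ?thesis by simp
qed

section \<open>The Bargmann transform\<close>

definition cplx :: "real^'n::finite \<Rightarrow> real^'n \<Rightarrow> complex^'n" where
  "cplx u v = (\<chi> k. Complex (u $ k) (v $ k))"

lemma cplx_nth [simp]: "cplx u v $ k = Complex (u $ k) (v $ k)"
  by (simp add: cplx_def)

lemma continuous_on_cplx: "continuous_on UNIV (\<lambda>p. cplx (fst p) (snd p))"
  unfolding cplx_def Complex_eq by (intro continuous_intros)

lemma borel_measurable_cplx [measurable]:
  "(\<lambda>p. cplx (fst p) (snd p)) \<in> borel_measurable (borel \<Otimes>\<^sub>M borel)"
  unfolding borel_prod by (rule borel_measurable_continuous_onI[OF continuous_on_cplx])

lemma Basis_complex_vec: "(Basis :: (complex^'n::finite) set) = range (\<lambda>k. axis k 1) \<union> range (\<lambda>k. axis k \<i>)"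
  by (auto simp: Basis_vec_def Basis_complex_def)

text \<open>The Fock norm is estimated by integrating over the imaginary part first, where the
  Bargmann transform is a Fourier transform. It suffices to compare the measures on boxes: the basis
  consists of the vectors \<open>axis k 1\<close> and \<open>axis k \<i>\<close>, so a box in C^n is
  a product of a real and an imaginary box.\<close>

lemma lborel_complex_vec:
  "(lborel :: (complex^'n::finite) measure) = distr (lborel \<Otimes>\<^sub>M lborel) borel (\<lambda>p. cplx (fst p) (snd p))"
proof (rule lborel_eqI)
  fix l u :: "complex^'n" assume le: "\<And>b. b \<in> Basis \<Longrightarrow> l \<bullet> b \<le> u \<bullet> b"
  define lR lI uR uI :: "real^'n" where "lR = (\<chi> k. Re (l $ k))" and "lI = (\<chi> k. Im (l $ k))"
    and "uR = (\<chi> k. Re (u $ k))" and "uI = (\<chi> k. Im (u $ k))"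
  note defs = lR_def lI_def uR_def uI_def
  have leR: "Re (l $ k) \<le> Re (u $ k)" and leI: "Im (l $ k) \<le> Im (u $ k)" for k
    using le[of "axis k 1"] le[of "axis k \<i>"] by (auto simp: Basis_complex_vec inner_axis inner_complex_def)
  have "(\<lambda>p. cplx (fst p) (snd p)) -` box l u = box lR uR \<times> box lI uI"
  proof (rule set_eqI)
    fix p :: "(real^'n) \<times> (real^'n)"
    have "cplx (fst p) (snd p) \<in> box l u \<longleftrightarrow>
      (\<forall>k. Re (l $ k) < fst p $ k \<and> fst p $ k < Re (u $ k)) \<and> (\<forall>k. Im (l $ k) < snd p $ k \<and> snd p $ k < Im (u $ k))"
      unfolding mem_box Basis_complex_vec ball_Un by (simp add: inner_axis inner_complex_def)
    moreover have "p \<in> box lR uR \<times> box lI uI \<longleftrightarrow>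
      (\<forall>k. Re (l $ k) < fst p $ k \<and> fst p $ k < Re (u $ k)) \<and> (\<forall>k. Im (l $ k) < snd p $ k \<and> snd p $ k < Im (u $ k))"
      unfolding mem_Times_iff mem_box Basis_vec_eq_range by (simp add: inner_axis defs)
    ultimately show "p \<in> (\<lambda>p. cplx (fst p) (snd p)) -` box l u \<longleftrightarrow> p \<in> box lR uR \<times> box lI uI"
      by simp
  qed
  hence "emeasure (distr (lborel \<Otimes>\<^sub>M lborel) borel (\<lambda>p. cplx (fst p) (snd p))) (box l u)
    = emeasure lborel (box lR uR) * emeasure lborel (box lI uI)"
    by (simp add: emeasure_distr space_pair_measure lborel.emeasure_pair_measure_Times)
  also have "emeasure lborel (box lR uR) = ennreal (\<Prod>k\<in>UNIV. Re ((u - l) $ k))"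
    using leR by (subst emeasure_lborel_box)
      (auto simp: Basis_vec_eq_range inner_axis defs prod.reindex inj_on_def axis_eq_axis)
  also have "emeasure lborel (box lI uI) = ennreal (\<Prod>k\<in>UNIV. Im ((u - l) $ k))"
    using leI by (subst emeasure_lborel_box)
      (auto simp: Basis_vec_eq_range inner_axis defs prod.reindex inj_on_def axis_eq_axis)
  also have "ennreal (\<Prod>k\<in>UNIV. Re ((u - l) $ k)) * ennreal (\<Prod>k\<in>UNIV. Im ((u - l) $ k))
    = ennreal ((\<Prod>k\<in>UNIV. Re ((u - l) $ k)) * (\<Prod>k\<in>UNIV. Im ((u - l) $ k)))"
    using leR leI by (intro ennreal_mult[symmetric] prod_nonneg) auto
  also have "(\<Prod>k\<in>UNIV. Re ((u - l) $ k)) * (\<Prod>k\<in>UNIV. Im ((u - l) $ k)) = (\<Prod>b\<in>Basis. (u - l) \<bullet> b)"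
    unfolding Basis_complex_vec
    by (subst prod.union_disjoint)
      (auto simp: inner_axis inner_complex_def prod.reindex inj_on_def axis_eq_axis)
  finally show "emeasure (distr (lborel \<Otimes>\<^sub>M lborel) borel (\<lambda>p. cplx (fst p) (snd p))) (box l u) = ennreal (\<Prod>b\<in>Basis. (u - l) \<bullet> b)" .
qed simp

lemma nn_integral_complex_vec:
  assumes [measurable]: "f \<in> borel_measurable borel"
  shows "(\<integral>\<^sup>+z. f z \<partial>lborel) = (\<integral>\<^sup>+u. (\<integral>\<^sup>+v. f (cplx u v) \<partial>lborel) \<partial>lborel)"
  by (subst lborel_complex_vec, subst nn_integral_distr, measurable)
    (simp add: lborel.nn_integral_fst[symmetric])

section \<open>The Bargmann kernel and its Gaussian bounds\<close>

lemma bil_cvec_cvec: "bil (cvec x) (cvec x) = of_real ((norm x)\<^sup>2)"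
  unfolding norm_vec_sq by (simp add: bil_def cvec_def power2_eq_square)

lemma bil_add_left: "bil (u + v) w = bil u w + bil v w"
  by (simp add: bil_def distrib_right sum.distrib)

lemma bil_diff_left: "bil (u - v) w = bil u w - bil v w"
  by (simp add: bil_def left_diff_distrib sum_subtractf)

lemma bil_scaleR_left: "bil (r *\<^sub>R u) w = r *\<^sub>R bil u w"
  by (simp add: bil_def scaleR_sum_right)

lemma bil_scale_left: "bil (a *s u) w = a * bil u w"
  by (simp add: bil_def sum_distrib_left mult.assoc)

lemma bil_commute: "bil u v = bil v u"
  by (simp add: bil_def mult.commute)

text \<open>Bounding each coordinate by the full norms costs the factor \<open>CARD('n)\<close>.
  This is harmless, since only linear growth in \<open>norm x\<close> matters against the
  Gaussian.\<close>

lemma norm_bil_cvec_le: "norm (bil z (cvec x)) \<le> real CARD('n) * norm x * norm (z :: complex^'n::finite)"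
proof -
  have "norm (bil z (cvec x)) \<le> (\<Sum>k\<in>UNIV. norm (z $ k * cvec x $ k))"
    unfolding bil_def by (rule norm_sum)
  also have "\<dots> \<le> (\<Sum>k\<in>(UNIV :: 'n set). norm z * norm x)"
  proof (rule sum_mono)
    fix k
    show "norm (z $ k * cvec x $ k) \<le> norm z * norm x"
      using Finite_Cartesian_Product.norm_nth_le[of z k] Finite_Cartesian_Product.norm_nth_le[of x k]
      by (simp add: norm_mult cvec_def mult_mono)
  qed
  finally show ?thesis by (simp add: algebra_simps)
qed

definition bker :: "real \<Rightarrow> complex^'n::finite \<Rightarrow> real^'n \<Rightarrow> complex" where
  "bker lam z x = exp (- (of_real lam / 4) * bil z z + of_real lam * bil z (cvec x)
             - (of_real lam / 2) * bil (cvec x) (cvec x))"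

lemma bargmann_bker:
  "bargmann lam \<phi> z = of_real ((lam / pi) powr (real CARD('n) / 4)) * (\<integral>x. bker lam z x * \<phi> x \<partial>lborel)"
  for z :: "complex^'n::finite"
  by (simp add: bargmann_def bker_def)

lemma borel_measurable_bker [measurable]: "bker lam z \<in> borel_measurable borel"
  unfolding bker_def bil_def cvec_def by simp

text \<open>Completing the square: \<open>lam * u * x - lam / 2 * x^2\<close> is
  \<open>lam / 2 * u^2 - lam / 2 * (u - x)^2\<close>, while the imaginary part of z contributes only
  the wave.\<close>

lemma bker_cplx:
  "bker lam (cplx u v) x = (exp (- (of_real lam / 4) * bil (cplx u v) (cplx u v)) * of_real (exp (lam / 2 * (norm u)\<^sup>2)))
    * (wave (\<lambda>_. lam) v x * of_real (exp (- lam / 2 * (norm (u - x))\<^sup>2)))"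
proof -
  have "of_real lam * bil (cplx u v) (cvec x) - (of_real lam / 2) * bil (cvec x) (cvec x)
    = of_real (lam / 2 * (norm u)\<^sup>2) + \<i> * of_real (\<Sum>k\<in>UNIV. lam * v $ k * x $ k) + of_real (- lam / 2 * (norm (u - x))\<^sup>2)"
    by (simp add: complex_eq_iff bil_def cvec_def norm_vec_sq sum_distrib_left sum_subtractf[symmetric]
          sum.distrib[symmetric] sum_negf[symmetric] sum_divide_distrib)
      (intro conjI sum.cong refl; simp add: field_simps power2_eq_square)
  thus ?thesis
    unfolding bker_def wave_def add_diff_eq[symmetric] by (simp only: exp_add exp_of_real mult.assoc)
qed

lemma bargmann_cplx:
  fixes u v :: "real^'n::finite"
  shows "bargmann lam \<phi> (cplx u v) = (of_real ((lam / pi) powr (real CARD('n) / 4))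
      * exp (- (of_real lam / 4) * bil (cplx u v) (cplx u v)) * of_real (exp (lam / 2 * (norm u)\<^sup>2)))
    * fourier (\<lambda>_. lam) (\<lambda>x. of_real (exp (- lam / 2 * (norm (u - x))\<^sup>2)) * \<phi> x) v"
  unfolding bargmann_bker bker_cplx fourier_def mult.assoc integral_mult_right_zero ..

text \<open>The product is dominated by the sum of the squares of its factors. In the square of the
  exponential, \<open>2 * s * norm x\<close> is at most \<open>a * (norm x)^2 + s^2 / a\<close>,
  which still leaves the decay \<open>- a * (norm x)^2\<close>. The linear term
  \<open>s * norm x\<close> is there for the growth of the Bargmann kernel.\<close>

lemma gaussian_mult_L2_integrable:
  fixes \<phi> :: "real^'n::finite \<Rightarrow> complex"
  assumes \<phi>: "\<phi> \<in> L2" and a: "a > 0"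
  shows "integrable lborel (\<lambda>x. exp (- a * (norm x)\<^sup>2 + s * norm x) * norm (\<phi> x))"
proof -
  have [measurable]: "\<phi> \<in> borel_measurable borel" and \<phi>2: "integrable lborel (\<lambda>x. (norm (\<phi> x))\<^sup>2)"
    using \<phi> by (auto simp: L2_def)
  have "integrable lborel (\<lambda>x. exp (s\<^sup>2 / a) * exp (- a * (norm x)\<^sup>2) + (norm (\<phi> x))\<^sup>2)"
    by (intro Bochner_Integration.integrable_add integrable_mult_right integrable_gaussian a \<phi>2)
  thus ?thesis
  proof (rule Bochner_Integration.integrable_bound)
    show "AE x in lborel. norm (exp (- a * (norm x)\<^sup>2 + s * norm x) * norm (\<phi> x))
      \<le> norm (exp (s\<^sup>2 / a) * exp (- a * (norm x)\<^sup>2) + (norm (\<phi> x))\<^sup>2)"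
    proof (intro AE_I2)
      fix x :: "real^'n"
      let ?e = "exp (- a * (norm x)\<^sup>2 + s * norm x)"
      have "2 * (s * norm x) = a * (norm x)\<^sup>2 + s\<^sup>2 / a - (a * norm x - s)\<^sup>2 / a"
        using a by (simp add: field_simps power2_eq_square)
      moreover have "(a * norm x - s)\<^sup>2 / a \<ge> 0" using a by simp
      ultimately have "2 * (s * norm x) \<le> a * (norm x)\<^sup>2 + s\<^sup>2 / a" by linarith
      hence "2 * (- a * (norm x)\<^sup>2 + s * norm x) \<le> s\<^sup>2 / a + - a * (norm x)\<^sup>2" by simp
      hence "?e\<^sup>2 \<le> exp (s\<^sup>2 / a) * exp (- a * (norm x)\<^sup>2)"
        unfolding exp_double[symmetric] exp_add[symmetric] by (simp only: exp_le_cancel_iff)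
      moreover have "?e * norm (\<phi> x) \<le> ?e\<^sup>2 + (norm (\<phi> x))\<^sup>2"
      proof -
        have "0 \<le> ?e * norm (\<phi> x)" by simp
        thus ?thesis using sum_squares_bound[of ?e "norm (\<phi> x)"] by (simp only: mult.assoc)
      qed
      ultimately have "?e * norm (\<phi> x) \<le> exp (s\<^sup>2 / a) * exp (- a * (norm x)\<^sup>2) + (norm (\<phi> x))\<^sup>2" by linarith
      thus "norm (?e * norm (\<phi> x)) \<le> norm (exp (s\<^sup>2 / a) * exp (- a * (norm x)\<^sup>2) + (norm (\<phi> x))\<^sup>2)"
        by simp
    qed
  qed simp
qed

lemma norm_bker_le:
  fixes z :: "complex^'n::finite"
  assumes "lam > 0"
  shows "norm (bker lam z x) \<le> norm (exp (- (of_real lam / 4) * bil z z)) * exp (- (lam / 2) * (norm x)\<^sup>2 + lam * (real CARD('n) * norm z) * norm x)"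
proof -
  have "Re (of_real lam * bil z (cvec x)) \<le> lam * (real CARD('n) * norm x * norm z)"
    using assms complex_Re_le_cmod[of "bil z (cvec x)"] norm_bil_cvec_le[of z x] by (simp add: mult_left_mono)
  hence "exp (Re (of_real lam * bil z (cvec x)) - lam / 2 * (norm x)\<^sup>2) \<le> exp (- (lam / 2) * (norm x)\<^sup>2 + lam * (real CARD('n) * norm z) * norm x)"
    by (simp add: algebra_simps)
  moreover have "norm (bker lam z x) = norm (exp (- (of_real lam / 4) * bil z z)) * exp (Re (of_real lam * bil z (cvec x)) - lam / 2 * (norm x)\<^sup>2)"
    unfolding bker_def bil_cvec_cvec by (simp flip: exp_add)
  ultimately show ?thesis by (simp add: mult_left_mono)
qed

text \<open>The purely imaginary points \<open>cplx 0 v\<close> already determine the function: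
  there the transform is a nonzero factor times the Fourier transform of
  \<open>exp (- lam / 2 * (norm x)^2) * \<phi> x\<close>, which is integrable for every \<phi> in
  \<open>L2\<close>.\<close>

lemma bargmann_inj:
  fixes \<phi> \<psi> :: "real^'n::finite \<Rightarrow> complex"
  assumes lam: "lam > 0" and \<phi>: "\<phi> \<in> L2" and \<psi>: "\<psi> \<in> L2" and eq: "bargmann lam \<phi> = bargmann lam \<psi>"
  shows "AE x in lborel. \<phi> x = \<psi> x"
proof -
  let ?e = "\<lambda>x::real^'n. complex_of_real (exp (- lam / 2 * (norm (0 - x))\<^sup>2))"
  have int: "integrable lborel (\<lambda>x. ?e x * f x)" if f: "f \<in> L2" for f
  proof (rule Bochner_Integration.integrable_bound)
    show "integrable lborel (\<lambda>x. exp (- (lam / 2) * (norm x)\<^sup>2 + 0 * norm x) * norm (f x))"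
      using lam by (intro gaussian_mult_L2_integrable f) simp
    have [measurable]: "f \<in> borel_measurable borel" using f by (simp add: L2_def)
    show "(\<lambda>x. ?e x * f x) \<in> borel_measurable lborel" by measurable
  qed (simp add: norm_mult)
  have "AE x in lborel. ?e x * \<phi> x - ?e x * \<psi> x = 0"
  proof (rule fourier_unique[where c=lam])
    show "integrable lborel (\<lambda>x. ?e x * \<phi> x - ?e x * \<psi> x)" using int \<phi> \<psi> by simp
    fix v
    have "fourier (\<lambda>_. lam) (\<lambda>x. ?e x * \<phi> x - ?e x * \<psi> x) v
      = fourier (\<lambda>_. lam) (\<lambda>x. ?e x * \<phi> x) v - fourier (\<lambda>_. lam) (\<lambda>x. ?e x * \<psi> x) v"
      unfolding fourier_def right_diff_distrib
      by (intro Bochner_Integration.integral_diff integrable_wave_mult int \<phi> \<psi>)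
    also have "fourier (\<lambda>_. lam) (\<lambda>x. ?e x * \<phi> x) v = fourier (\<lambda>_. lam) (\<lambda>x. ?e x * \<psi> x) v"
      using fun_cong[OF eq, of "cplx 0 v"] lam unfolding bargmann_cplx by simp
    finally show "fourier (\<lambda>_. lam) (\<lambda>x. ?e x * \<phi> x - ?e x * \<psi> x) v = 0" by simp
  qed (use lam in simp)
  thus ?thesis by (simp flip: right_diff_distrib)
qed

text \<open>The whole quadratic dependence on z is the factor \<open>exp (q z)\<close> in front of
  the integral; the exponent that remains inside is affine in z, so
  \<open>exp_integral_has_derivative\<close> applies at each \<open>z0\<close>. Complex homogeneity
  is then read off the two derivatives \<open>DF\<close> and \<open>Dq\<close>.\<close>

lemma holomorphic_Cn_bargmann:
  fixes \<phi> :: "real^'n::finite \<Rightarrow> complex"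
  assumes lam: "lam > 0" and \<phi>: "\<phi> \<in> L2"
  shows "holomorphic_Cn (bargmann lam \<phi>)"
  unfolding holomorphic_Cn_def
proof
  fix z0 :: "complex^'n"
  have [measurable]: "\<phi> \<in> borel_measurable borel" using \<phi> by (auto simp: L2_def)
  define h where "h = (\<lambda>x. exp (of_real lam * bil z0 (cvec x) - (of_real lam / 2) * bil (cvec x) (cvec x)) * \<phi> x)"
  have h_meas [measurable]: "h \<in> borel_measurable borel" unfolding h_def bil_def cvec_def by simp
  have h_eq: "h x = exp (of_real lam / 4 * bil z0 z0) * (bker lam z0 x * \<phi> x)" for x
    unfolding h_def bker_def mult.assoc[symmetric] exp_add[symmetric] by (simp add: algebra_simps)
  define L where "L = (\<lambda>(x::real^'n) v. of_real lam * bil v (cvec x) :: complex)"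
  define F where "F = (\<lambda>z. \<integral>x. exp (L x (z - z0)) * h x \<partial>lborel)"
  define DF where "DF = (\<lambda>v. \<integral>x. L x v * h x \<partial>lborel)"
  have F: "(F has_derivative DF) (at z0)"
    unfolding F_def DF_def
  proof (rule exp_integral_has_derivative[where P="\<lambda>x. lam * real CARD('n) * norm x" and r=1])
    show "linear (L x)" for x
      by (intro linearI) (simp_all add: L_def bil_add_left bil_scaleR_left distrib_left)
    show "norm (L x v) \<le> lam * real CARD('n) * norm x * norm v" for x v
      using norm_bil_cvec_le[of v x] lam by (simp add: L_def norm_mult mult_left_mono mult.assoc)
    let ?K = "norm (exp (of_real lam / 4 * bil z0 z0)) * norm (exp (- (of_real lam / 4) * bil z0 z0))"
    let ?e = "\<lambda>x::real^'n. exp (- (lam / 2) * (norm x)\<^sup>2 + (lam * real CARD('n) + lam * (real CARD('n) * norm z0)) * norm x)"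
    have "integrable lborel (\<lambda>x. ?K * (?e x * norm (\<phi> x)))"
      using lam by (intro integrable_mult_right gaussian_mult_L2_integrable \<phi>) simp
    thus "integrable lborel (\<lambda>x. exp (1 * (lam * real CARD('n) * norm x)) * norm (h x))"
    proof (rule Bochner_Integration.integrable_bound)
      show "AE x in lborel. norm (exp (1 * (lam * real CARD('n) * norm x)) * norm (h x)) \<le> norm (?K * (?e x * norm (\<phi> x)))"
      proof (intro AE_I2)
        fix x :: "real^'n"
        let ?A = "norm (exp (of_real lam / 4 * bil z0 z0))" and ?B = "norm (exp (- (of_real lam / 4) * bil z0 z0))"
        let ?f = "exp (- (lam / 2) * (norm x)\<^sup>2 + lam * (real CARD('n) * norm z0) * norm x)"
        have "norm (h x) \<le> ?A * ((?B * ?f) * norm (\<phi> x))"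
          unfolding h_eq norm_mult by (intro mult_left_mono mult_right_mono norm_bker_le lam) auto
        hence "exp (lam * real CARD('n) * norm x) * norm (h x) \<le> exp (lam * real CARD('n) * norm x) * (?A * ((?B * ?f) * norm (\<phi> x)))"
          by (rule mult_left_mono) simp
        also have "\<dots> = ?K * ((exp (lam * real CARD('n) * norm x) * ?f) * norm (\<phi> x))" by (simp only: mult_ac)
        also have "exp (lam * real CARD('n) * norm x) * ?f = ?e x"
          unfolding exp_add[symmetric] by (simp add: algebra_simps)
        finally show "norm (exp (1 * (lam * real CARD('n) * norm x)) * norm (h x)) \<le> norm (?K * (?e x * norm (\<phi> x)))"
          by simp
      qed
    qed simp
  qed (use lam in \<open>auto simp: L_def bil_def cvec_def\<close>)
  define q where "q = (\<lambda>z::complex^'n. - (of_real lam / 4) * bil z z)"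
  define Dq where "Dq = (\<lambda>v::complex^'n. - (of_real lam / 4) * (2 * bil z0 v))"
  have q: "(q has_derivative Dq) (at z0)"
  proof -
    have nth: "((\<lambda>z. z $ k) has_derivative (\<lambda>v. v $ k)) (at z0)" for k
      by (rule bounded_linear.has_derivative[OF bounded_linear_vec_nth has_derivative_ident])
    have "((\<lambda>z. \<Sum>k\<in>UNIV. z $ k * z $ k) has_derivative (\<lambda>v. \<Sum>k\<in>UNIV. z0 $ k * v $ k + v $ k * z0 $ k)) (at z0)"
      by (intro has_derivative_sum has_derivative_mult nth)
    moreover have "(\<Sum>k\<in>UNIV. z0 $ k * v $ k + v $ k * z0 $ k) = 2 * bil z0 v" for v
      by (simp add: bil_def sum_distrib_left mult.commute)
    ultimately show ?thesis
      unfolding q_def Dq_def bil_def[of z z for z] by (intro has_derivative_mult_right) simp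
  qed
  have eq: "((\<lambda>z. exp (q z)) has_derivative (\<lambda>v. exp (q z0) * Dq v)) (at z0)"
    using has_derivative_compose[OF q, of exp "(*) (exp (q z0))"] DERIV_exp[of "q z0"]
    unfolding has_field_derivative_def by blast
  define c where "c = complex_of_real ((lam / pi) powr (real CARD('n) / 4))"
  have B: "bargmann lam \<phi> z = c * (exp (q z) * F z)" for z
  proof -
    have "bker lam z x * \<phi> x = exp (q z) * (exp (L x (z - z0)) * h x)" for x
    proof -
      have "L x (z - z0) = of_real lam * bil z (cvec x) - of_real lam * bil z0 (cvec x)"
        by (simp add: L_def bil_diff_left right_diff_distrib)
      thus ?thesis
        unfolding bker_def h_def q_def mult.assoc[symmetric] exp_add[symmetric] by (simp add: algebra_simps)
    qed
    thus ?thesis unfolding bargmann_bker F_def c_def by simp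
  qed
  have "(bargmann lam \<phi> has_derivative (\<lambda>v. c * (exp (q z0) * DF v + exp (q z0) * Dq v * F z0))) (at z0)"
    unfolding B[abs_def] by (intro has_derivative_mult_right has_derivative_mult eq F)
  moreover have "c * (exp (q z0) * DF (a *s v) + exp (q z0) * Dq (a *s v) * F z0)
      = a * (c * (exp (q z0) * DF v + exp (q z0) * Dq v * F z0))" for a v
  proof -
    have "L x (a *s v) * h x = a * (L x v * h x)" for x
      by (simp add: L_def bil_scale_left)
    hence "DF (a *s v) = a * DF v" unfolding DF_def by (simp only: integral_mult_right_zero)
    moreover have "Dq (a *s v) = a * Dq v" by (simp add: Dq_def bil_commute[of z0] bil_scale_left)
    ultimately show ?thesis by (simp add: algebra_simps)
  qed
  ultimately show "\<exists>D. (bargmann lam \<phi> has_derivative D) (at z0) \<and> (\<forall>c v. D (c *s v) = c * D v)" by blast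
qed

lemma nn_integral_shift:
  fixes f :: "'a::euclidean_space \<Rightarrow> ennreal"
  assumes [measurable]: "f \<in> borel_measurable borel"
  shows "(\<integral>\<^sup>+x. f (a + x) \<partial>lborel) = (\<integral>\<^sup>+x. f x \<partial>lborel)"
  by (subst (2) lborel_distr_plus[of a, symmetric], subst nn_integral_distr) simp_all

text \<open>For a fixed real part u, Plancherel's inequality in v bounds the inner integral by the
  squared norm of \<phi> cut off by a Gaussian centred at u. Integrating over u by Tonelli replaces
  the cut-off by its constant mass.\<close>

lemma bargmann_in_fock_space:
  fixes \<phi> :: "real^'n::finite \<Rightarrow> complex"
  assumes lam: "lam > 0" and \<phi>: "\<phi> \<in> L1 \<inter> L2"
  shows "bargmann lam \<phi> \<in> fock_space lam"
proof -
  have [measurable]: "\<phi> \<in> borel_measurable borel" and \<phi>1: "integrable lborel \<phi>"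
    and \<phi>2: "integrable lborel (\<lambda>x. (norm (\<phi> x))\<^sup>2)"
    using \<phi> by (auto simp: L1_def L2_def)
  have hol: "holomorphic_Cn (bargmann lam \<phi>)" using \<phi> by (intro holomorphic_Cn_bargmann lam) simp
  hence "continuous_on UNIV (bargmann lam \<phi>)"
    unfolding holomorphic_Cn_def continuous_on_eq_continuous_within
    by (metis has_derivative_continuous)
  hence [measurable]: "bargmann lam \<phi> \<in> borel_measurable borel" by (rule borel_measurable_continuous_onI)
  define c where "c = (lam / pi) powr (real CARD('n) / 4)"
  define C where "C = (\<Prod>k\<in>(UNIV :: 'n set). 2 * pi / \<bar>lam\<bar>)"
  define g where "g = (\<lambda>(u::real^'n) x. complex_of_real (exp (- lam / 2 * (norm (u - x))\<^sup>2)) * \<phi> x)"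
  let ?f = "\<lambda>z. (norm (bargmann lam \<phi> z))\<^sup>2 * exp (- lam * (norm z)\<^sup>2 / 2)"
  \<comment> \<open>The Fock weight cancels the squared modulus of the Gaussian prefactor exactly:
    both exponents are \<open>lam / 2\<close> times the squared norm of z, with opposite
    signs.\<close>
  have f_eq: "?f (cplx u v) = c\<^sup>2 * (norm (fourier (\<lambda>_. lam) (g u) v))\<^sup>2" for u v :: "real^'n"
  proof -
    have bil_eq: "Re (bil (cplx u v) (cplx u v)) = (norm u)\<^sup>2 - (norm v)\<^sup>2"
      unfolding norm_vec_sq by (simp add: bil_def power2_eq_square sum_subtractf)
    have norm_eq: "(norm (cplx u v))\<^sup>2 = (norm u)\<^sup>2 + (norm v)\<^sup>2"
    proof -
      have "(norm (cplx u v))\<^sup>2 = (\<Sum>k\<in>UNIV. (norm (cplx u v $ k))\<^sup>2)"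
        by (simp add: norm_vec_def L2_set_def sum_nonneg)
      thus ?thesis unfolding norm_vec_sq by (simp add: cmod_power2 sum.distrib)
    qed
    have "norm (bargmann lam \<phi> (cplx u v))
      = c * exp (- lam / 4 * ((norm u)\<^sup>2 - (norm v)\<^sup>2)) * exp (lam / 2 * (norm u)\<^sup>2) * norm (fourier (\<lambda>_. lam) (g u) v)"
      unfolding bargmann_cplx norm_mult g_def c_def using bil_eq by simp
    also have "\<dots> = c * (exp (- lam / 4 * ((norm u)\<^sup>2 - (norm v)\<^sup>2)) * exp (lam / 2 * (norm u)\<^sup>2)) * norm (fourier (\<lambda>_. lam) (g u) v)"
      by (simp only: mult.assoc)
    also have "exp (- lam / 4 * ((norm u)\<^sup>2 - (norm v)\<^sup>2)) * exp (lam / 2 * (norm u)\<^sup>2) = exp (lam / 4 * ((norm u)\<^sup>2 + (norm v)\<^sup>2))"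
      unfolding exp_add[symmetric] by (simp add: algebra_simps)
    finally have "?f (cplx u v) = c\<^sup>2 * (norm (fourier (\<lambda>_. lam) (g u) v))\<^sup>2
      * ((exp (lam / 4 * ((norm u)\<^sup>2 + (norm v)\<^sup>2)))\<^sup>2 * exp (- lam * ((norm u)\<^sup>2 + (norm v)\<^sup>2) / 2))"
      by (simp add: power_mult_distrib norm_eq mult_ac)
    also have "(exp (lam / 4 * ((norm u)\<^sup>2 + (norm v)\<^sup>2)))\<^sup>2 * exp (- lam * ((norm u)\<^sup>2 + (norm v)\<^sup>2) / 2) = 1"
      unfolding exp_double[symmetric] exp_add[symmetric] by simp
    finally show ?thesis by simp
  qed
  have g_int: "integrable lborel (g u)" for u
  proof (rule Bochner_Integration.integrable_bound[OF \<phi>1])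
    show "AE x in lborel. norm (g u x) \<le> norm (\<phi> x)"
      using lam by (intro AE_I2) (simp add: g_def norm_mult mult_left_le_one_le)
  qed (simp add: g_def)
  have g_norm: "(norm (g u x))\<^sup>2 = exp (- lam * (norm (u - x))\<^sup>2) * (norm (\<phi> x))\<^sup>2" for u x
    by (simp add: g_def norm_mult power_mult_distrib flip: exp_double)
  have "(\<integral>\<^sup>+z. ennreal (?f z) \<partial>lborel) = (\<integral>\<^sup>+u. (\<integral>\<^sup>+v. ennreal (c\<^sup>2) * ennreal ((norm (fourier (\<lambda>_. lam) (g u) v))\<^sup>2) \<partial>lborel) \<partial>lborel)"
  proof -
    have "(\<integral>\<^sup>+z. ennreal (?f z) \<partial>lborel) = (\<integral>\<^sup>+u. (\<integral>\<^sup>+v. ennreal (?f (cplx u v)) \<partial>lborel) \<partial>lborel)"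
      by (rule nn_integral_complex_vec) measurable
    thus ?thesis by (simp only: f_eq ennreal_mult zero_le_power2)
  qed
  also have "\<dots> \<le> (\<integral>\<^sup>+u. ennreal (c\<^sup>2) * (ennreal C * (\<integral>\<^sup>+x. ennreal ((norm (g u x))\<^sup>2) \<partial>lborel)) \<partial>lborel)"
  proof (rule nn_integral_mono)
    fix u :: "real^'n"
    have [measurable]: "g u \<in> borel_measurable borel" unfolding g_def by measurable
    have "(\<integral>\<^sup>+v. ennreal (c\<^sup>2) * ennreal ((norm (fourier (\<lambda>_. lam) (g u) v))\<^sup>2) \<partial>lborel)
      = ennreal (c\<^sup>2) * (\<integral>\<^sup>+v. ennreal ((norm (fourier (\<lambda>_. lam) (g u) v))\<^sup>2) \<partial>lborel)"
      by (rule nn_integral_cmult) measurable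
    also have "\<dots> \<le> ennreal (c\<^sup>2) * (ennreal C * (\<integral>\<^sup>+x. ennreal ((norm (g u x))\<^sup>2) \<partial>lborel))"
      unfolding C_def using lam by (intro mult_left_mono plancherel_le g_int) auto
    finally show "(\<integral>\<^sup>+v. ennreal (c\<^sup>2) * ennreal ((norm (fourier (\<lambda>_. lam) (g u) v))\<^sup>2) \<partial>lborel)
      \<le> ennreal (c\<^sup>2) * (ennreal C * (\<integral>\<^sup>+x. ennreal ((norm (g u x))\<^sup>2) \<partial>lborel))" .
  qed
  also have "\<dots> = ennreal (c\<^sup>2) * (ennreal C * (\<integral>\<^sup>+u. (\<integral>\<^sup>+x. ennreal (exp (- lam * (norm (u - x))\<^sup>2)) * ennreal ((norm (\<phi> x))\<^sup>2) \<partial>lborel) \<partial>lborel))"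
    unfolding g_norm by (simp add: nn_integral_cmult ennreal_mult)
  also have "(\<integral>\<^sup>+u. (\<integral>\<^sup>+x. ennreal (exp (- lam * (norm (u - x))\<^sup>2)) * ennreal ((norm (\<phi> x))\<^sup>2) \<partial>lborel) \<partial>lborel)
    = (\<integral>\<^sup>+x. (\<integral>\<^sup>+u. ennreal (exp (- lam * (norm (u - x))\<^sup>2)) * ennreal ((norm (\<phi> x))\<^sup>2) \<partial>lborel) \<partial>lborel)"
    using lborel_pair.Fubini[of "\<lambda>(u, x). ennreal (exp (- lam * (norm (u - x))\<^sup>2)) * ennreal ((norm (\<phi> x))\<^sup>2)"]
    by simp
  also have "\<dots> = (\<integral>\<^sup>+u. ennreal (exp (- lam * (norm (u::real^'n))\<^sup>2)) \<partial>lborel) * (\<integral>\<^sup>+x. ennreal ((norm (\<phi> x))\<^sup>2) \<partial>lborel)"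
  proof -
    have "(\<integral>\<^sup>+u. ennreal (exp (- lam * (norm (u - x))\<^sup>2)) \<partial>lborel) = (\<integral>\<^sup>+u. ennreal (exp (- lam * (norm (u::real^'n))\<^sup>2)) \<partial>lborel)" for x :: "real^'n"
      using nn_integral_shift[of "\<lambda>u. ennreal (exp (- lam * (norm u)\<^sup>2))" "- x"] by simp
    thus ?thesis by (simp add: nn_integral_multc nn_integral_cmult)
  qed
  also have "(\<integral>\<^sup>+u. ennreal (exp (- lam * (norm (u::real^'n))\<^sup>2)) \<partial>lborel) = ennreal (\<integral>u. exp (- lam * (norm (u::real^'n))\<^sup>2) \<partial>lborel)"
    using integrable_gaussian[OF lam] by (intro nn_integral_eq_integral) auto
  also have "(\<integral>\<^sup>+x. ennreal ((norm (\<phi> x))\<^sup>2) \<partial>lborel) = ennreal (\<integral>x. (norm (\<phi> x))\<^sup>2 \<partial>lborel)"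
    using \<phi>2 by (intro nn_integral_eq_integral) auto
  finally have "(\<integral>\<^sup>+z. ennreal (?f z) \<partial>lborel) < \<infinity>"
    by (rule order.strict_trans1) (simp add: ennreal_mult_less_top)
  hence "integrable lborel ?f"
    by (intro integrableI_bounded) simp_all
  hence "integrable (fock_measure lam) ?f"
    unfolding fock_measure_def using lam by (subst integrable_density) auto
  thus ?thesis using hol by (simp add: fock_space_def)
qed

section \<open>The kernel\<close>

definition diag :: "('n::finite \<Rightarrow> complex) \<Rightarrow> complex^'n^'n" where
  "diag d = (\<chi> j k. if j = k then d k else 0)"

lemma diag_mult: "diag d ** diag d' = diag (\<lambda>k. d k * d' k)"
  by (simp add: diag_def matrix_matrix_mult_def vec_eq_iff mult_delta_left mult_delta_right)

lemma diag_one: "diag (\<lambda>_. 1) = mat 1"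
  by (auto simp: diag_def mat_def vec_eq_iff)

lemma diag_diff: "diag d - diag d' = diag (\<lambda>k. d k - d' k)"
  by (auto simp: diag_def vec_eq_iff)

lemma diag_mult_vec: "(diag d *v z) $ k = d k * z $ k"
  by (simp add: diag_def matrix_vector_mult_def mult_delta_left)

lemma bilM_diag: "bilM z (diag d) w = (\<Sum>k\<in>UNIV. z $ k * d k * w $ k)"
  by (simp add: bilM_def diag_def mult_delta_left mult_delta_right)

text \<open>\<open>matrix_inv\<close> is defined by choice: the explicit inverse shows that the
  choice is a two-sided inverse, and uniqueness of inverses identifies the two.\<close>

lemma matrix_inv_diag:
  assumes "\<And>k. d k \<noteq> 0"
  shows "matrix_inv (diag d) = diag (\<lambda>k. inverse (d k))"
proof -
  let ?B = "diag (\<lambda>k. inverse (d k))"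
  have B: "diag d ** ?B = mat 1" "?B ** diag d = mat 1"
    using assms by (simp_all add: diag_mult diag_one)
  hence "diag d ** matrix_inv (diag d) = mat 1 \<and> matrix_inv (diag d) ** diag d = mat 1"
    unfolding matrix_inv_def by (intro someI[of "\<lambda>A'. diag d ** A' = mat 1 \<and> A' ** diag d = mat 1" ?B]) simp
  hence "matrix_inv (diag d) = (?B ** diag d) ** matrix_inv (diag d)"
    using B by simp
  also have "\<dots> = ?B" unfolding matrix_mul_assoc[symmetric]
    using \<open>diag d ** matrix_inv (diag d) = mat 1 \<and> _\<close> by simp
  finally show ?thesis .
qed

section \<open>Mehler's formula in one coordinate\<close>

lemma csqrt_of_real_mult: "r > 0 \<Longrightarrow> csqrt (of_real r * z) = of_real (sqrt r) * csqrt z"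
proof (rule csqrt_unique)
  assume r: "r > 0"
  have "(complex_of_real (sqrt r))\<^sup>2 = of_real r"
    using r by (metis of_real_power less_imp_le real_sqrt_pow2)
  thus "(of_real (sqrt r) * csqrt z)\<^sup>2 = of_real r * z" by (simp add: power_mult_distrib)
  show "0 < Re (of_real (sqrt r) * csqrt z) \<or> Re (of_real (sqrt r) * csqrt z) = 0 \<and> 0 \<le> Im (of_real (sqrt r) * csqrt z)"
    using csqrt_principal[of z] r by (auto simp del: csqrt.sel)
qed

text \<open>A diagonal entry of \<open>torus_mat \<alpha> (- t)\<close>, whence the minus
  sign.\<close>

definition rot :: "real \<Rightarrow> complex" where "rot \<theta> = exp (- \<i> * of_real \<theta>)"

lemma rot_nonzero [simp]: "rot \<theta> \<noteq> 0"
  by (simp add: rot_def)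

lemma rot_eq: "rot \<theta> = Complex (cos \<theta>) (- sin \<theta>)"
  by (simp add: rot_def complex_eq_iff Re_exp Im_exp)

lemma cos_eq_rot: "complex_of_real (cos \<theta>) = \<i> * of_real (sin \<theta>) + rot \<theta>"
  by (simp add: rot_eq complex_eq_iff)

lemma sin_mult_rot: "2 * (\<i> * of_real (sin \<theta>) * rot \<theta>) = 1 - (rot \<theta>)\<^sup>2"
  using sin_cos_squared_add[of \<theta>]
  by (simp add: rot_eq complex_eq_iff power2_eq_square algebra_simps)

lemma rot_sq: "(rot \<theta>)\<^sup>2 = exp (- 2 * \<i> * of_real \<theta>)"
  by (simp add: rot_def mult.assoc flip: exp_double)

text \<open>Used with \<open>p = \<i> sin \<theta>\<close>, \<open>c = cos \<theta>\<close> and \<open>e = exp(-\<i>\<theta>)\<close>, where the assumptions make the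
  identity rational in \<open>e\<close>.\<close>

lemma mehler_exponent:
  fixes z y p e c l :: complex
  assumes c: "c = p + e" and pe: "2 * (p * e) = 1 - e\<^sup>2" and p: "p \<noteq> 0"
  shows "- (l / 4) * z\<^sup>2 - l / 2 * (c / p) * y\<^sup>2 + l * (z + y / p)\<^sup>2 * (p * e) / 2
    = - (l / 4) * (e * z)\<^sup>2 + l * (e * z) * y - l / 2 * y\<^sup>2"
proof -
  have pe': "p * e = (1 - e\<^sup>2) / 2" unfolding pe[symmetric] by simp
  have "l * (z + y / p)\<^sup>2 * (p * e) / 2 = l / 2 * z\<^sup>2 * (p * e) + l * (e * z) * y + l / 2 * (e / p) * y\<^sup>2"
    using p by (simp add: power2_eq_square field_simps)
  also have "l / 2 * z\<^sup>2 * (p * e) = l / 4 * z\<^sup>2 - l / 4 * (e * z)\<^sup>2"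
    unfolding pe' by (simp add: field_simps power2_eq_square)
  finally have F: "l * (z + y / p)\<^sup>2 * (p * e) / 2
    = l / 4 * z\<^sup>2 - l / 4 * (e * z)\<^sup>2 + l * (e * z) * y + l / 2 * (e / p) * y\<^sup>2" .
  have "l / 2 * (c / p) * y\<^sup>2 = l / 2 * y\<^sup>2 + l / 2 * (e / p) * y\<^sup>2"
    using p unfolding c by (simp add: add_divide_distrib algebra_simps)
  thus ?thesis unfolding F by simp
qed

text \<open>One coordinate of the intertwining relation; \<open>- a\<close> and \<open>b\<close> are
  the coefficients of x^2 and x in the product of the Bargmann kernel and the kernel. With
  \<open>p = \<i> * sin \<theta>\<close> one finds \<open>a = lam / (1 - (rot \<theta>)^2)\<close>,
  so the Gaussian integral produces the very root \<open>csqrt (1 - (rot \<theta>)^2)\<close> by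
  which the kernel divides, on the same branch. What remains is an identity of exponents.\<close>

lemma mehler_integral:
  fixes z :: complex and y :: real
  assumes lam: "lam > 0" and s: "sin \<theta> \<noteq> 0"
  defines "a \<equiv> of_real (lam / 2) * (1 - \<i> * of_real (cos \<theta> / sin \<theta>))"
    and "b \<equiv> of_real lam * z - \<i> * of_real (lam * y / sin \<theta>)"
  shows "Re a > 0"
    and "exp (- (of_real lam / 4) * z\<^sup>2 + \<i> * of_real (lam / 2 * (cos \<theta> / sin \<theta>) * y\<^sup>2))
      * (of_real (sqrt (lam / pi)) * inverse (csqrt (1 - (rot \<theta>)\<^sup>2)))
      * (csqrt (of_real pi / a) * exp (b\<^sup>2 / (4 * a)))
    = exp (- (of_real lam / 4) * (rot \<theta> * z)\<^sup>2 + of_real lam * (rot \<theta> * z) * of_real y - of_real lam / 2 * (of_real y)\<^sup>2)"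
proof -
  show "Re a > 0" using lam by (simp add: a_def)
  define p where "p = \<i> * of_real (sin \<theta>)"
  have p: "p \<noteq> 0" using s by (simp add: p_def)
  have pe: "2 * (p * rot \<theta>) = 1 - (rot \<theta>)\<^sup>2" unfolding p_def by (rule sin_mult_rot)
  have c: "complex_of_real (cos \<theta>) = p + rot \<theta>" unfolding p_def by (rule cos_eq_rot)
  have ic: "\<i> * of_real (cos \<theta> / sin \<theta>) = - (of_real (cos \<theta>) / p)"
    using s by (simp add: p_def field_simps)
  \<comment> \<open>\<open>p + cos \<theta>\<close> is \<open>exp (\<i> * \<theta>)\<close>, the
    inverse of \<open>rot \<theta>\<close>.\<close>
  have "a * (2 * (p * rot \<theta>)) = of_real lam"
  proof -
    have "a = of_real (lam / 2) * ((p + of_real (cos \<theta>)) / p)"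
      unfolding a_def ic using p by (simp add: add_divide_distrib)
    hence "a * (2 * (p * rot \<theta>)) = of_real lam * ((p + of_real (cos \<theta>)) * rot \<theta>)"
      using p by simp
    also have "(p + of_real (cos \<theta>)) * rot \<theta> = 1"
      using pe unfolding c by (simp add: algebra_simps power2_eq_square)
    finally show ?thesis by simp
  qed
  hence a_eq: "a = of_real lam / (2 * (p * rot \<theta>))"
    using p by (simp add: field_simps)
  have "csqrt (of_real pi / a) = csqrt (of_real (pi / lam) * (1 - (rot \<theta>)\<^sup>2))"
    unfolding a_eq pe[symmetric] by simp
  also have "\<dots> = of_real (sqrt (pi / lam)) * csqrt (1 - (rot \<theta>)\<^sup>2)"
    using lam by (intro csqrt_of_real_mult) simp
  finally have sq: "csqrt (of_real pi / a) = of_real (sqrt (pi / lam)) * csqrt (1 - (rot \<theta>)\<^sup>2)" .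
  have w: "csqrt (1 - (rot \<theta>)\<^sup>2) \<noteq> 0" unfolding pe[symmetric] using p by simp
  have "sqrt (lam / pi) * sqrt (pi / lam) = 1"
    using lam by (simp flip: real_sqrt_mult)
  hence "complex_of_real (sqrt (lam / pi)) * of_real (sqrt (pi / lam)) = 1"
    unfolding of_real_mult[symmetric] by simp
  hence one: "(of_real (sqrt (lam / pi)) * inverse (csqrt (1 - (rot \<theta>)\<^sup>2))) * csqrt (of_real pi / a) = 1"
    unfolding sq using w by (simp add: field_simps)
  have b: "b = of_real lam * (z + of_real y / p)"
    using s by (simp add: b_def p_def field_simps)
  have ba: "b\<^sup>2 / (4 * a) = of_real lam * (z + of_real y / p)\<^sup>2 * (p * rot \<theta>) / 2"
    unfolding b a_eq using lam p by (simp add: power2_eq_square)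
  have ph: "\<i> * of_real (lam / 2 * (cos \<theta> / sin \<theta>) * y\<^sup>2) = - (of_real lam / 2 * (of_real (cos \<theta>) / p) * (of_real y)\<^sup>2)"
  proof -
    have "\<i> * of_real (lam / 2 * (cos \<theta> / sin \<theta>) * y\<^sup>2) = of_real lam / 2 * (\<i> * of_real (cos \<theta> / sin \<theta>)) * (of_real y)\<^sup>2"
      by simp
    thus ?thesis unfolding ic by simp
  qed
  have "exp (- (of_real lam / 4) * z\<^sup>2 + \<i> * of_real (lam / 2 * (cos \<theta> / sin \<theta>) * y\<^sup>2))
      * (of_real (sqrt (lam / pi)) * inverse (csqrt (1 - (rot \<theta>)\<^sup>2)))
      * (csqrt (of_real pi / a) * exp (b\<^sup>2 / (4 * a)))
    = ((of_real (sqrt (lam / pi)) * inverse (csqrt (1 - (rot \<theta>)\<^sup>2))) * csqrt (of_real pi / a))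
      * (exp (- (of_real lam / 4) * z\<^sup>2 + \<i> * of_real (lam / 2 * (cos \<theta> / sin \<theta>) * y\<^sup>2)) * exp (b\<^sup>2 / (4 * a)))"
    by (simp only: mult_ac)
  also have "\<dots> = exp (- (of_real lam / 4) * z\<^sup>2 - of_real lam / 2 * (of_real (cos \<theta>) / p) * (of_real y)\<^sup>2
     + of_real lam * (z + of_real y / p)\<^sup>2 * (p * rot \<theta>) / 2)"
    unfolding one ph ba exp_add[symmetric] by simp
  also have "\<dots> = exp (- (of_real lam / 4) * (rot \<theta> * z)\<^sup>2 + of_real lam * (rot \<theta> * z) * of_real y - of_real lam / 2 * (of_real y)\<^sup>2)"
    by (subst mehler_exponent[OF c pe p]) (rule refl)
  finally show "exp (- (of_real lam / 4) * z\<^sup>2 + \<i> * of_real (lam / 2 * (cos \<theta> / sin \<theta>) * y\<^sup>2))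
      * (of_real (sqrt (lam / pi)) * inverse (csqrt (1 - (rot \<theta>)\<^sup>2)))
      * (csqrt (of_real pi / a) * exp (b\<^sup>2 / (4 * a)))
    = exp (- (of_real lam / 4) * (rot \<theta> * z)\<^sup>2 + of_real lam * (rot \<theta> * z) * of_real y - of_real lam / 2 * (of_real y)\<^sup>2)" .
qed

section \<open>The trigonometric kernel as a Fourier kernel with chirps\<close>

definition phase :: "real \<Rightarrow> ('n::finite \<Rightarrow> real) \<Rightarrow> real^'n \<Rightarrow> complex" where
  "phase lam \<theta> x = exp (\<i> * of_real (\<Sum>k\<in>UNIV. lam / 2 * (cos (\<theta> k) / sin (\<theta> k)) * (x $ k)\<^sup>2))"

text \<open>The scalar \<open>u\<close> stands for \<open>chi t\<close> and the angles
  \<open>\<theta> k\<close> for \<open>\<alpha> k t\<close>, so that the analysis of the kernel is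
  free of the torus action.\<close>

definition kconst :: "real \<Rightarrow> ('n::finite \<Rightarrow> real) \<Rightarrow> complex \<Rightarrow> complex" where
  "kconst lam \<theta> u = of_real ((lam / pi) powr (real CARD('n) / 2)) * u *
     (\<Prod>k\<in>UNIV. inverse (csqrt (1 - (rot (\<theta> k))\<^sup>2)))"

lemma norm_phase [simp]: "norm (phase lam \<theta> x) = 1"
  by (simp add: phase_def)

lemma borel_measurable_phase [measurable (raw)]:
  assumes [measurable]: "f \<in> borel_measurable M"
  shows "(\<lambda>p. phase lam \<theta> (f p)) \<in> borel_measurable M"
  unfolding phase_def by measurable

lemma kernel_trig_eq:
  "kernel_trig lam \<alpha> chi t x y = kconst lam (\<lambda>k. \<alpha> k t) (chi t) *
    (phase lam (\<lambda>k. \<alpha> k t) x * wave (\<lambda>k. - lam / sin (\<alpha> k t)) x y * phase lam (\<lambda>k. \<alpha> k t) y)"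
proof -
  have eq: "(of_real lam / 2) * \<i> * (\<Sum>k\<in>UNIV. of_real (cos (\<alpha> k t) / sin (\<alpha> k t) * ((x $ k)\<^sup>2 + (y $ k)\<^sup>2)))
          - of_real lam * \<i> * (\<Sum>k\<in>UNIV. of_real (inverse (sin (\<alpha> k t)) * x $ k * y $ k))
    = \<i> * of_real (\<Sum>k\<in>UNIV. lam / 2 * (cos (\<alpha> k t) / sin (\<alpha> k t)) * (x $ k)\<^sup>2)
      + \<i> * of_real (\<Sum>k\<in>UNIV. - lam / sin (\<alpha> k t) * x $ k * y $ k)
      + \<i> * of_real (\<Sum>k\<in>UNIV. lam / 2 * (cos (\<alpha> k t) / sin (\<alpha> k t)) * (y $ k)\<^sup>2)"
  proof -
    have "of_real lam / 2 * \<i> * of_real (cos (\<alpha> k t) / sin (\<alpha> k t) * ((x $ k)\<^sup>2 + (y $ k)\<^sup>2))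
          - of_real lam * \<i> * of_real (inverse (sin (\<alpha> k t)) * x $ k * y $ k)
      = \<i> * of_real (lam / 2 * (cos (\<alpha> k t) / sin (\<alpha> k t)) * (x $ k)\<^sup>2)
        + \<i> * of_real (- lam / sin (\<alpha> k t) * x $ k * y $ k)
        + \<i> * of_real (lam / 2 * (cos (\<alpha> k t) / sin (\<alpha> k t)) * (y $ k)\<^sup>2)" for k
      unfolding minus_divide_left[symmetric] divide_inverse[of lam "sin _"] by (simp add: algebra_simps)
    thus ?thesis
      unfolding of_real_sum sum_distrib_left sum.distrib[symmetric] sum_subtractf[symmetric]
      by (intro sum.cong refl)
  qed
  show ?thesis
    unfolding kernel_trig_def kconst_def phase_def wave_def rot_sq eq exp_add ..
qed

section \<open>Equality of the matrix and trigonometric forms\<close>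

lemma torus_mat_minus:
  assumes "\<And>k. linear (\<alpha> k)"
  shows "torus_mat \<alpha> (- t) = diag (\<lambda>k. rot (\<alpha> k t))"
  by (simp add: torus_mat_def diag_def rot_def linear_neg[OF assms] vec_eq_iff)

lemma kernel_exponent:
  fixes l X Y u q :: complex
  shows "l / 2 * (X * X + Y * Y) + l * (Y * (- (u / 2) - 1 / 2) * Y - 2 * (X * (- (q / 2)) * Y) + X * (- (u / 2) - 1 / 2) * X)
    = l / 2 * (- u) * (X\<^sup>2 + Y\<^sup>2) - l * (- q) * X * Y"
  by (simp add: field_simps power2_eq_square)

text \<open>All matrices are diagonal. With e = \<open>rot (\<alpha> k t)\<close> and p =
  \<open>\<i> * sin (\<alpha> k t)\<close>, the entries are
  \<open>e / (e^2 - 1) = - 1 / (2 * p)\<close> and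
  \<open>1 / (e^2 - 1) = - cos (\<alpha> k t) / (2 * p) - 1 / 2\<close>; the terms
  \<open>- 1 / 2\<close> cancel the real Gaussian factor of the matrix form.\<close>

lemma kernel_mat_eq_kernel_trig:
  assumes lin: "\<And>k. linear (\<alpha> k)" and s: "\<And>k. sin (\<alpha> k t) \<noteq> 0"
  shows "kernel_mat lam \<alpha> chi t x y = kernel_trig lam \<alpha> chi t x y"
proof -
  let ?e = "\<lambda>k. rot (\<alpha> k t)"
  let ?d = "\<lambda>k. ?e k * ?e k - 1"
  have pe: "2 * (\<i> * of_real (sin (\<alpha> k t)) * ?e k) = 1 - ?e k * ?e k" for k
    using sin_mult_rot[of "\<alpha> k t"] by (simp add: power2_eq_square)
  have d: "?d k \<noteq> 0" for k
  proof -
    have "?d k = - (2 * (\<i> * of_real (sin (\<alpha> k t)) * ?e k))" unfolding pe by simp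
    moreover have "2 * (\<i> * of_real (sin (\<alpha> k t)) * ?e k) \<noteq> 0" using s[of k] by simp
    ultimately show ?thesis by (metis neg_equal_0_iff_equal)
  qed
  have A2: "diag ?e ** diag ?e - mat 1 = diag ?d" "mat 1 - diag ?e ** diag ?e = diag (\<lambda>k. 1 - ?e k * ?e k)"
    unfolding diag_one[symmetric] by (simp_all add: diag_mult diag_diff)
  have det: "Det_inv_sqrt (diag (\<lambda>k. 1 - ?e k * ?e k)) = (\<Prod>k\<in>UNIV. inverse (csqrt (1 - exp (- 2 * \<i> * of_real (\<alpha> k t)))))"
    unfolding Det_inv_sqrt_def rot_sq[symmetric] by (simp add: diag_def power2_eq_square)
  have expo: "of_real lam / 2 * (bil (cvec x) (cvec x) + bil (cvec y) (cvec y))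
      + of_real lam * (bilM (cvec y) (diag (\<lambda>k. inverse (?d k))) (cvec y)
        - 2 * bilM (cvec x) (diag (\<lambda>k. ?e k * inverse (?d k))) (cvec y)
        + bilM (cvec x) (diag (\<lambda>k. inverse (?d k))) (cvec x))
    = (of_real lam / 2) * \<i> * (\<Sum>k\<in>UNIV. of_real (cos (\<alpha> k t) / sin (\<alpha> k t) * ((x $ k)\<^sup>2 + (y $ k)\<^sup>2)))
          - of_real lam * \<i> * (\<Sum>k\<in>UNIV. of_real (inverse (sin (\<alpha> k t)) * x $ k * y $ k))"
    unfolding bilM_diag bil_def sum_distrib_left sum.distrib[symmetric] sum_subtractf[symmetric]
  proof (intro sum.cong refl)
    fix k
    define p where "p = \<i> * of_real (sin (\<alpha> k t))"
    have p: "p \<noteq> 0" using s[of k] by (simp add: p_def)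
    have dk: "?d k = - (2 * (p * ?e k))" unfolding p_def pe by simp
    have i1: "?e k * inverse (?d k) = - ((1 / p) / 2)" unfolding dk using p by (simp add: field_simps)
    have i2: "inverse (?d k) = - ((of_real (cos (\<alpha> k t)) / p) / 2) - 1 / 2"
    proof -
      \<comment> \<open>\<open>2 * p + e\<close> is \<open>exp (\<i> * \<theta>)\<close>, so this
        product with \<open>rot \<theta>\<close> can stand in for the numerator 1.\<close>
      have key: "(2 * p + ?e k) * ?e k = 1" using pe[of k] by (simp add: p_def algebra_simps)
      have "inverse (?d k) = - (1 / (2 * p * ?e k))" unfolding dk using p by (simp add: field_simps)
      also have "1 / (2 * p * ?e k) = (2 * p + ?e k) * ?e k / (2 * p * ?e k)" by (simp only: key)
      also have "\<dots> = (2 * p + ?e k) / (2 * p)"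
        by (rule mult_divide_mult_cancel_right) simp
      also have "2 * p + ?e k = p + of_real (cos (\<alpha> k t))"
        using cos_eq_rot[of "\<alpha> k t"] by (simp add: p_def)
      finally show ?thesis using p by (simp add: add_divide_distrib)
    qed
    have r1: "\<i> * of_real (cos (\<alpha> k t) / sin (\<alpha> k t)) = - (of_real (cos (\<alpha> k t)) / p)"
      and r2: "\<i> * of_real (inverse (sin (\<alpha> k t))) = - (1 / p)"
      using s[of k] by (simp_all add: p_def field_simps)
    show "of_real lam / 2 * (cvec x $ k * cvec x $ k + cvec y $ k * cvec y $ k)
      + of_real lam * (cvec y $ k * inverse (?d k) * cvec y $ k - 2 * (cvec x $ k * (?e k * inverse (?d k)) * cvec y $ k) + cvec x $ k * inverse (?d k) * cvec x $ k)
      = of_real lam / 2 * \<i> * of_real (cos (\<alpha> k t) / sin (\<alpha> k t) * ((x $ k)\<^sup>2 + (y $ k)\<^sup>2))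
        - of_real lam * \<i> * of_real (inverse (sin (\<alpha> k t)) * x $ k * y $ k)"
    proof -
      have "of_real lam / 2 * \<i> * of_real (cos (\<alpha> k t) / sin (\<alpha> k t) * ((x $ k)\<^sup>2 + (y $ k)\<^sup>2))
          - of_real lam * \<i> * of_real (inverse (sin (\<alpha> k t)) * x $ k * y $ k)
        = of_real lam / 2 * (\<i> * of_real (cos (\<alpha> k t) / sin (\<alpha> k t))) * ((cvec x $ k)\<^sup>2 + (cvec y $ k)\<^sup>2)
          - of_real lam * (\<i> * of_real (inverse (sin (\<alpha> k t)))) * cvec x $ k * cvec y $ k"
        unfolding cvec_def by simp
      thus ?thesis
        unfolding r1 r2 unfolding i1 unfolding i2 by (simp only: kernel_exponent)
    qed
  qed
  show ?thesis
    unfolding kernel_mat_def kernel_trig_def Let_def torus_mat_minus[OF lin] A2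
    unfolding diag_mult matrix_inv_diag[OF d] det expo[symmetric] exp_add
    by (simp only: mult.assoc)
qed

section \<open>The kernel operator and its Bargmann transform\<close>

definition kern :: "real \<Rightarrow> ('n::finite \<Rightarrow> real) \<Rightarrow> complex \<Rightarrow> real^'n \<Rightarrow> real^'n \<Rightarrow> complex" where
  "kern lam \<theta> u x y = kconst lam \<theta> u * (phase lam \<theta> x * wave (\<lambda>k. - lam / sin (\<theta> k)) x y * phase lam \<theta> y)"

lemma norm_kern: "norm (kern lam \<theta> u x y) = norm (kconst lam \<theta> u)"
  by (simp add: kern_def norm_mult)

lemma borel_measurable_kern [measurable (raw)]:
  assumes [measurable]: "f \<in> borel_measurable M" "g \<in> borel_measurable M"
  shows "(\<lambda>p. kern lam \<theta> u (f p) (g p)) \<in> borel_measurable M"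
  unfolding kern_def by measurable

lemma integrable_phase_mult:
  assumes "integrable lborel \<phi>"
  shows "integrable lborel (\<lambda>y. phase lam \<theta> y * \<phi> y)"
proof (rule Bochner_Integration.integrable_bound[OF assms])
  show "(\<lambda>y. phase lam \<theta> y * \<phi> y) \<in> borel_measurable lborel"
    using borel_measurable_integrable[OF assms] by measurable
qed (simp add: norm_mult)

lemma integrable_kern_mult:
  assumes "integrable lborel \<phi>"
  shows "integrable lborel (\<lambda>y. kern lam \<theta> u x y * \<phi> y)"
proof (rule Bochner_Integration.integrable_bound)
  show "integrable lborel (\<lambda>y. kconst lam \<theta> u * \<phi> y)" using assms by simp
  show "(\<lambda>y. kern lam \<theta> u x y * \<phi> y) \<in> borel_measurable lborel"
    using borel_measurable_integrable[OF assms] by measurable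
qed (simp add: norm_mult norm_kern)

lemma kern_integral_eq_fourier:
  "(\<integral>y. kern lam \<theta> u x y * \<phi> y \<partial>lborel)
    = (kconst lam \<theta> u * phase lam \<theta> x) * fourier (\<lambda>k. - lam / sin (\<theta> k)) (\<lambda>y. phase lam \<theta> y * \<phi> y) x"
  unfolding fourier_def integral_mult_right_zero[symmetric]
  by (intro Bochner_Integration.integral_cong refl) (simp add: kern_def)

text \<open>Both chirps have modulus one, so they change neither the norm before nor the norm after
  the Fourier transform; the hypothesis on \<open>sin\<close> makes its frequencies nonzero, as
  Plancherel's inequality asks.\<close>

lemma kern_integral_L2:
  fixes \<phi> :: "real^'n::finite \<Rightarrow> complex"
  assumes lam: "lam > 0" and s: "\<And>k. sin (\<theta> k) \<noteq> 0" and \<phi>: "\<phi> \<in> L1 \<inter> L2"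
  shows "(\<lambda>x. \<integral>y. kern lam \<theta> u x y * \<phi> y \<partial>lborel) \<in> L2"
proof -
  have [measurable]: "\<phi> \<in> borel_measurable borel" and \<phi>1: "integrable lborel \<phi>"
    and \<phi>2: "integrable lborel (\<lambda>x. (norm (\<phi> x))\<^sup>2)"
    using \<phi> by (auto simp: L1_def L2_def)
  let ?c = "\<lambda>k. - lam / sin (\<theta> k)"
  let ?g = "\<lambda>y. phase lam \<theta> y * \<phi> y"
  have "(\<integral>\<^sup>+x. ennreal ((norm (fourier ?c ?g x))\<^sup>2) \<partial>lborel)
    \<le> ennreal (\<Prod>k\<in>UNIV. 2 * pi / \<bar>?c k\<bar>) * (\<integral>\<^sup>+y. ennreal ((norm (?g y))\<^sup>2) \<partial>lborel)"
    using lam s by (intro plancherel_le integrable_phase_mult \<phi>1) simp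
  also have "(\<integral>\<^sup>+y. ennreal ((norm (?g y))\<^sup>2) \<partial>lborel) = ennreal (\<integral>y. (norm (\<phi> y))\<^sup>2 \<partial>lborel)"
    using \<phi>2 by (simp add: norm_mult nn_integral_eq_integral)
  finally have "(\<integral>\<^sup>+x. ennreal ((norm (fourier ?c ?g x))\<^sup>2) \<partial>lborel) < \<infinity>"
    by (rule order.strict_trans1) (simp add: ennreal_mult_less_top)
  hence "integrable lborel (\<lambda>x. (norm (fourier ?c ?g x))\<^sup>2)"
    by (intro integrableI_bounded) simp_all
  hence "integrable lborel (\<lambda>x. (norm (kconst lam \<theta> u))\<^sup>2 * (norm (fourier ?c ?g x))\<^sup>2)" by simp
  thus ?thesis
    by (simp add: L2_def kern_integral_eq_fourier norm_mult power_mult_distrib)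
qed

lemma kconst_prod:
  fixes \<theta> :: "'n::finite \<Rightarrow> real"
  assumes "lam > 0"
  shows "kconst lam \<theta> u = u * (\<Prod>k\<in>UNIV. of_real (sqrt (lam / pi)) * inverse (csqrt (1 - (rot (\<theta> k))\<^sup>2)))"
proof -
  have "(lam / pi) powr (real CARD('n) / 2) = ((lam / pi) powr (1 / 2)) powr real CARD('n)"
    by (simp add: powr_powr)
  also have "\<dots> = sqrt (lam / pi) ^ CARD('n)"
    using assms by (simp add: powr_half_sqrt powr_realpow)
  finally show ?thesis by (simp add: kconst_def prod.distrib)
qed

lemma bker_prod:
  "bker lam z y = (\<Prod>k\<in>UNIV. exp (- (of_real lam / 4) * (z $ k)\<^sup>2 + of_real lam * z $ k * of_real (y $ k) - of_real lam / 2 * (of_real (y $ k))\<^sup>2))"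
  unfolding bker_def exp_sum[OF finite, symmetric] bil_def cvec_def
  by (simp add: sum.distrib sum_subtractf sum_distrib_left sum_negf power2_eq_square mult.assoc)

text \<open>The intertwining relation at the level of kernels, for fixed y. The chirp and wave in x
  only change imaginary parts in the Gaussian coming from \<open>bker\<close>, so the integral
  converges and splits into coordinates.\<close>

lemma bker_kern_integral:
  fixes z :: "complex^'n::finite"
  assumes lam: "lam > 0" and s: "\<And>k. sin (\<theta> k) \<noteq> 0"
  shows "integrable lborel (bker lam z)" (is ?I)
    and "(\<integral>x. bker lam z x * kern lam \<theta> u x y \<partial>lborel) = u * bker lam (diag (\<lambda>k. rot (\<theta> k)) *v z) y" (is ?E)
proof -
  have "bker lam z x = exp (- (of_real lam / 4) * bil z z)
    * exp (\<Sum>k\<in>UNIV. - of_real (lam / 2) * of_real ((x $ k)\<^sup>2) + of_real lam * z $ k * of_real (x $ k))" for x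
    unfolding bker_def exp_add[symmetric] bil_def[of _ "cvec x"] unfolding cvec_def
    by (simp add: sum.distrib sum_distrib_left sum_negf power2_eq_square algebra_simps sum_subtractf)
  hence bker_eq: "bker lam z = (\<lambda>x. exp (- (of_real lam / 4) * bil z z)
    * exp (\<Sum>k\<in>UNIV. - of_real (lam / 2) * of_real ((x $ k)\<^sup>2) + of_real lam * z $ k * of_real (x $ k)))" ..
  show ?I
    unfolding bker_eq using lam by (intro integrable_mult_right integrable_complex_gaussian_vec) simp
  \<comment> \<open>\<open>- a k\<close> and \<open>b k\<close> are the coefficients of x_k^2 and
    x_k in the total exponent; \<open>E k\<close> collects the factors without x, and
    \<open>S k\<close> is the share of coordinate \<open>k\<close> in the constant
    \<open>kconst\<close>.\<close>
  define a where "a = (\<lambda>k. of_real (lam / 2) * (1 - \<i> * of_real (cos (\<theta> k) / sin (\<theta> k))))"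
  define b where "b = (\<lambda>k. of_real lam * z $ k - \<i> * of_real (lam * y $ k / sin (\<theta> k)))"
  define E where "E = (\<lambda>k. exp (- (of_real lam / 4) * (z $ k)\<^sup>2 + \<i> * of_real (lam / 2 * (cos (\<theta> k) / sin (\<theta> k)) * (y $ k)\<^sup>2)))"
  define S where "S = (\<lambda>k. of_real (sqrt (lam / pi)) * inverse (csqrt (1 - (rot (\<theta> k))\<^sup>2)))"
  have a: "Re (a k) > 0" for k unfolding a_def using lam s by (intro mehler_integral(1)) auto
  have "bker lam z x * kern lam \<theta> u x y = (u * (\<Prod>k\<in>UNIV. E k * S k)) * exp (\<Sum>k\<in>UNIV. - a k * of_real ((x $ k)\<^sup>2) + b k * of_real (x $ k))" for x
  proof -
    have "bker lam z x * (phase lam \<theta> x * wave (\<lambda>k. - lam / sin (\<theta> k)) x y * phase lam \<theta> y)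
      = (\<Prod>k\<in>UNIV. E k) * exp (\<Sum>k\<in>UNIV. - a k * of_real ((x $ k)\<^sup>2) + b k * of_real (x $ k))"
      unfolding bker_prod phase_def wave_def E_def exp_sum[OF finite, symmetric] exp_add[symmetric]
        of_real_sum sum_distrib_left sum.distrib[symmetric]
    proof (intro arg_cong[where f=exp] sum.cong refl)
      fix k
      show "- (of_real lam / 4) * (z $ k)\<^sup>2 + of_real lam * z $ k * of_real (x $ k) - of_real lam / 2 * (of_real (x $ k))\<^sup>2
         + (\<i> * of_real (lam / 2 * (cos (\<theta> k) / sin (\<theta> k)) * (x $ k)\<^sup>2)
            + \<i> * of_real (- lam / sin (\<theta> k) * x $ k * y $ k)
            + \<i> * of_real (lam / 2 * (cos (\<theta> k) / sin (\<theta> k)) * (y $ k)\<^sup>2))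
        = - (of_real lam / 4) * (z $ k)\<^sup>2 + \<i> * of_real (lam / 2 * (cos (\<theta> k) / sin (\<theta> k)) * (y $ k)\<^sup>2)
         + (- a k * of_real ((x $ k)\<^sup>2) + b k * of_real (x $ k))"
        unfolding a_def b_def by (simp add: algebra_simps)
    qed
    thus ?thesis
      unfolding kern_def kconst_prod[OF lam] S_def[symmetric] prod.distrib by (simp add: mult.left_commute mult.assoc)
  qed
  hence "(\<integral>x. bker lam z x * kern lam \<theta> u x y \<partial>lborel)
    = (u * (\<Prod>k\<in>UNIV. E k * S k)) * (\<Prod>k\<in>UNIV. csqrt (of_real pi / a k) * exp ((b k)\<^sup>2 / (4 * a k)))"
    by (simp only: integral_mult_right_zero complex_gaussian_integral_vec[OF a])
  also have "\<dots> = u * (\<Prod>k\<in>UNIV. E k * S k * (csqrt (of_real pi / a k) * exp ((b k)\<^sup>2 / (4 * a k))))"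
    by (simp only: prod.distrib mult.assoc)
  also have "(\<Prod>k\<in>UNIV. E k * S k * (csqrt (of_real pi / a k) * exp ((b k)\<^sup>2 / (4 * a k))))
    = bker lam (diag (\<lambda>k. rot (\<theta> k)) *v z) y"
    unfolding bker_prod diag_mult_vec E_def S_def a_def b_def
    by (intro prod.cong refl mehler_integral(2) lam s)
  finally show ?E .
qed

text \<open>Fubini: the kernel is bounded, \<open>bker lam z\<close> supplies integrability in x and
  \<phi> in y.\<close>

lemma bargmann_kern_integral:
  fixes \<phi> :: "real^'n::finite \<Rightarrow> complex"
  assumes lam: "lam > 0" and s: "\<And>k. sin (\<theta> k) \<noteq> 0" and \<phi>: "integrable lborel \<phi>"
  shows "bargmann lam (\<lambda>x. \<integral>y. kern lam \<theta> u x y * \<phi> y \<partial>lborel) z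
    = u * bargmann lam \<phi> (diag (\<lambda>k. rot (\<theta> k)) *v z)"
proof -
  have [measurable]: "\<phi> \<in> borel_measurable borel" using borel_measurable_integrable[OF \<phi>] by simp
  have int: "integrable (lborel \<Otimes>\<^sub>M lborel) (\<lambda>(x, y). bker lam z x * (kern lam \<theta> u x y * \<phi> y))"
  proof (rule Bochner_Integration.integrable_bound)
    show "integrable (lborel \<Otimes>\<^sub>M lborel) (\<lambda>(x, y). bker lam z x * (kconst lam \<theta> u * \<phi> y))"
      using \<phi> by (intro integrable_lborel_pair_mult bker_kern_integral(1)[OF lam s]) simp
    show "AE p in lborel \<Otimes>\<^sub>M lborel. norm (case p of (x, y) \<Rightarrow> bker lam z x * (kern lam \<theta> u x y * \<phi> y))
      \<le> norm (case p of (x, y) \<Rightarrow> bker lam z x * (kconst lam \<theta> u * \<phi> y))"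
      by (intro AE_I2) (auto simp: norm_mult norm_kern)
  qed measurable
  have "(\<integral>x. bker lam z x * (\<integral>y. kern lam \<theta> u x y * \<phi> y \<partial>lborel) \<partial>lborel)
    = (\<integral>x. (\<integral>y. bker lam z x * (kern lam \<theta> u x y * \<phi> y) \<partial>lborel) \<partial>lborel)"
    by (simp only: integral_mult_right_zero)
  also have "\<dots> = (\<integral>y. (\<integral>x. bker lam z x * (kern lam \<theta> u x y * \<phi> y) \<partial>lborel) \<partial>lborel)"
    by (rule lborel_pair.Fubini_integral[OF int, symmetric])
  also have "\<dots> = (\<integral>y. u * (bker lam (diag (\<lambda>k. rot (\<theta> k)) *v z) y * \<phi> y) \<partial>lborel)"
    unfolding mult.assoc[symmetric] integral_mult_left_zero bker_kern_integral(2)[OF lam s] ..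
  finally show ?thesis unfolding bargmann_bker by simp
qed

lemma kernel_trig_eq_kern: "kernel_trig lam \<alpha> chi t = kern lam (\<lambda>k. \<alpha> k t) (chi t)"
  by (intro ext) (simp add: kernel_trig_eq kern_def)

text \<open>Membership of B\<phi> in the Fock space is what allows \<open>sigma\<close> to be
  unfolded. The preimage chosen by \<open>inv_into\<close> and the kernel integral \<psi> lie in
  \<open>L2\<close> and have the same Bargmann transform, hence agree almost everywhere.\<close>

lemma is_kernel_kernel_trig:
  fixes \<alpha> :: "'n::finite \<Rightarrow> real ^ 'm::finite \<Rightarrow> real"
  assumes lam: "lam > 0" and lin: "\<And>k. linear (\<alpha> k)" and s: "\<And>k. sin (\<alpha> k t) \<noteq> 0"
  shows "is_kernel (sigma' lam \<alpha> chi t) (kernel_trig lam \<alpha> chi t)"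
  unfolding is_kernel_def kernel_trig_eq_kern
proof (intro ballI conjI allI)
  fix \<phi> :: "real^'n \<Rightarrow> complex" and x assume \<phi>: "\<phi> \<in> L1 \<inter> L2"
  hence \<phi>1: "integrable lborel \<phi>" by (simp add: L1_def)
  show "integrable lborel (\<lambda>y. kern lam (\<lambda>k. \<alpha> k t) (chi t) x y * \<phi> y)"
    by (rule integrable_kern_mult[OF \<phi>1])
  define \<psi> where "\<psi> = (\<lambda>x. \<integral>y. kern lam (\<lambda>k. \<alpha> k t) (chi t) x y * \<phi> y \<partial>lborel)"
  have \<psi>: "\<psi> \<in> L2" unfolding \<psi>_def by (rule kern_integral_L2[OF lam s \<phi>])
  have eq: "sigma lam \<alpha> chi t (bargmann lam \<phi>) = bargmann lam \<psi>"
    unfolding \<psi>_def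
    by (rule ext) (simp add: sigma_def bargmann_in_fock_space[OF lam \<phi>] torus_mat_minus[OF lin] bargmann_kern_integral[OF lam s \<phi>1])
  hence T: "sigma' lam \<alpha> chi t \<phi> = inv_into L2 (bargmann lam) (bargmann lam \<psi>)"
    by (simp add: sigma'_def bargmann_inv_def)
  have img: "bargmann lam \<psi> \<in> bargmann lam ` L2" using \<psi> by simp
  show "AE x in lborel. sigma' lam \<alpha> chi t \<phi> x = (\<integral>y. kern lam (\<lambda>k. \<alpha> k t) (chi t) x y * \<phi> y \<partial>lborel)"
    using bargmann_inj[OF lam inv_into_into[OF img] \<psi> f_inv_into_f[OF img]] unfolding T \<psi>_def .
qed

section \<open>Uniqueness of the kernel\<close>

lemma countable_Int_stable_generator:
  obtains G :: "'a::second_countable_topology set set"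
  where "countable G" "Int_stable G" "UNIV \<in> G" "sets borel = sigma_sets UNIV G"
proof -
  obtain B :: "'a set set" where B: "countable B" "topological_basis B"
    using ex_countable_basis by blast
  \<comment> \<open>Finite intersections of basic sets; the empty intersection supplies
    \<open>UNIV\<close>. Since all members are open and \<open>B\<close> is included,
    \<open>G\<close> is again a countable basis.\<close>
  define G where "G = Inter ` {F. finite F \<and> F \<subseteq> B}"
  have "countable G" unfolding G_def using B(1) by (intro countable_image countable_Collect_finite_subset)
  moreover have "Int_stable G"
  proof (unfold Int_stable_def G_def, clarsimp)
    fix F F' assume "finite F" "F \<subseteq> B" "finite F'" "F' \<subseteq> B"
    thus "\<Inter>F \<inter> \<Inter>F' \<in> Inter ` {F. finite F \<and> F \<subseteq> B}"
      by (intro image_eqI[of _ _ "F \<union> F'"]) auto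
  qed
  moreover have "UNIV \<in> G" unfolding G_def by (intro image_eqI[of _ _ "{}"]) auto
  moreover have "sets borel = sigma_sets UNIV G"
  proof -
    have "open A" if "A \<in> G" for A
      using that topological_basis_open[OF B(2)] by (auto simp: G_def intro!: open_Inter)
    moreover have "B \<subseteq> G"
    proof
      fix A assume "A \<in> B" thus "A \<in> G" unfolding G_def by (intro image_eqI[of _ _ "{A}"]) auto
    qed
    ultimately have "topological_basis G"
      using B(2) unfolding topological_basis_def by (meson order.trans)
    hence "borel = Sigma_Algebra.sigma UNIV G" using \<open>countable G\<close> by (intro borel_eq_countable_basis)
    hence "sets borel = sets (Sigma_Algebra.sigma UNIV G)" by (rule arg_cong)
    also have "\<dots> = sigma_sets UNIV G" by (rule sets_measure_of) simp
    finally show ?thesis .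
  qed
  ultimately show ?thesis by (rule that)
qed

text \<open>The null set of x in \<open>is_kernel\<close> depends on \<phi>; countably many test
  functions leave a single null set, outside which the sections \<open>b x\<close> and
  \<open>b' x\<close> are compared. Joint measurability of a kernel is not part of
  \<open>is_kernel\<close>, which is why the conclusion is an iterated almost-everywhere
  statement.\<close>

lemma is_kernel_unique:
  fixes b b' :: "real^'n::finite \<Rightarrow> real^'n \<Rightarrow> complex"
  assumes b: "is_kernel T b" and b': "is_kernel T b'"
  shows "AE x in lborel. AE y in lborel. b x y = b' x y"
proof -
  obtain G :: "(real^'n) set set" where G: "countable G" "Int_stable G" "UNIV \<in> G" "sets borel = sigma_sets UNIV G"
    by (rule countable_Int_stable_generator)
  have G_sets [measurable]: "A \<in> sets borel" if "A \<in> G" for A using that unfolding G(4) by (rule sigma_sets.Basic)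
  \<comment> \<open>The Gaussian puts the test functions into \<open>L1\<close> and
    \<open>L2\<close> even when \<open>A\<close> has infinite measure. It vanishes nowhere, so it
    can be cancelled in the end.\<close>
  define \<phi> where "\<phi> = (\<lambda>A y::real^'n. indicator A y * complex_of_real (exp (- (norm y)\<^sup>2)))"
  have \<phi>: "\<phi> A \<in> L1 \<inter> L2" if "A \<in> G" for A
  proof -
    note [measurable] = G_sets[OF that]
    have [measurable]: "\<phi> A \<in> borel_measurable borel" unfolding \<phi>_def by measurable
    have "integrable lborel (\<phi> A)"
    proof (rule Bochner_Integration.integrable_bound)
      show "integrable lborel (\<lambda>y::real^'n. exp (- 1 * (norm y)\<^sup>2))" by (rule integrable_gaussian) simp
    qed (auto simp: \<phi>_def norm_mult indicator_def)
    moreover have "integrable lborel (\<lambda>y. (norm (\<phi> A y))\<^sup>2)"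
    proof (rule Bochner_Integration.integrable_bound)
      show "integrable lborel (\<lambda>y::real^'n. exp (- 2 * (norm y)\<^sup>2))" by (rule integrable_gaussian) simp
    qed (auto simp: \<phi>_def norm_mult indicator_def simp flip: exp_double)
    ultimately show ?thesis by (simp add: L1_def L2_def)
  qed
  have "AE x in lborel. \<forall>A\<in>G. (\<integral>y. b x y * \<phi> A y \<partial>lborel) = (\<integral>y. b' x y * \<phi> A y \<partial>lborel)"
  proof (rule AE_ball_countable'[OF _ G(1)])
    fix A assume "A \<in> G"
    hence "AE x in lborel. T (\<phi> A) x = (\<integral>y. b x y * \<phi> A y \<partial>lborel)"
      "AE x in lborel. T (\<phi> A) x = (\<integral>y. b' x y * \<phi> A y \<partial>lborel)"
      using \<phi> b b' by (auto simp: is_kernel_def)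
    thus "AE x in lborel. (\<integral>y. b x y * \<phi> A y \<partial>lborel) = (\<integral>y. b' x y * \<phi> A y \<partial>lborel)"
      by eventually_elim simp
  qed
  thus ?thesis
  proof eventually_elim
    case (elim x)
    have int: "integrable lborel (\<lambda>y. b x y * \<phi> A y)" "integrable lborel (\<lambda>y. b' x y * \<phi> A y)" if "A \<in> G" for A
      using b b' \<phi>[OF that] by (auto simp: is_kernel_def)
    have "AE y in lborel. b x y * \<phi> UNIV y - b' x y * \<phi> UNIV y = 0"
    proof (rule AE_zero_Int_stable[OF _ G(2-4)])
      show "integrable lborel (\<lambda>y. b x y * \<phi> UNIV y - b' x y * \<phi> UNIV y)"
        using int[OF G(3)] by simp
      fix A assume A: "A \<in> G"
      have "(LINT y:A|lborel. b x y * \<phi> UNIV y - b' x y * \<phi> UNIV y) = (\<integral>y. b x y * \<phi> A y - b' x y * \<phi> A y \<partial>lborel)"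
        unfolding set_lebesgue_integral_def \<phi>_def
        by (intro Bochner_Integration.integral_cong refl) (auto simp: indicator_def)
      also have "\<dots> = 0" using int[OF A] elim A by simp
      finally show "(LINT y:A|lborel. b x y * \<phi> UNIV y - b' x y * \<phi> UNIV y) = 0" .
    qed
    thus ?case by eventually_elim (simp add: \<phi>_def)
  qed
qed

theorem proposition8p1:
  fixes lam :: real
    and \<alpha> :: "'n::finite \<Rightarrow> real ^ 'm::finite \<Rightarrow> real"
    and chi :: "real ^ 'm \<Rightarrow> complex"
    and t :: "real ^ 'm"
  assumes "lam > 0"
    and "\<And>k. linear (\<alpha> k)"
    and "unitary_character chi"
    and "\<And>k. \<not> (\<exists>j::int. \<alpha> k t = pi * of_int j)"
  shows "is_kernel (sigma' lam \<alpha> chi t) (kernel_mat lam \<alpha> chi t) \<and>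
    is_kernel (sigma' lam \<alpha> chi t) (kernel_trig lam \<alpha> chi t) \<and>
    (\<forall>x y. kernel_mat lam \<alpha> chi t x y = kernel_trig lam \<alpha> chi t x y) \<and>
    (\<forall>b. is_kernel (sigma' lam \<alpha> chi t) b \<longrightarrow>
       (AE x in lborel. AE y in lborel. b x y = kernel_mat lam \<alpha> chi t x y))"
proof -
  have s: "sin (\<alpha> k t) \<noteq> 0" for k
    using assms(4)[of k] by (auto simp: sin_zero_iff_int2 mult.commute)
  have eq: "kernel_mat lam \<alpha> chi t = kernel_trig lam \<alpha> chi t"
    by (intro ext kernel_mat_eq_kernel_trig assms(2) s)
  have k: "is_kernel (sigma' lam \<alpha> chi t) (kernel_trig lam \<alpha> chi t)"
    by (rule is_kernel_kernel_trig[OF assms(1,2) s])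
  show ?thesis unfolding eq using k is_kernel_unique[OF _ k] by simp
qed

end
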